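(* Let $X$ be a compact subset of a compact Euclidean neighbourhood retract $\mathrm E$. Then for every $k\in\mathbb N$ $$\check H^{\mathcal U}_k(X)\cong\check H_k(X).$$
   Context: Homology is taken with coefficients in $\mathbb Z$. A Euclidean neighbourhood retract is a space homeomorphic to a subset $Y\subset\mathbb R^n$ that is a retract of some open neighbourhood of $Y$ in $\mathbb R^n$. Čech homology via coverings. Let $Cov(X)$ be the set of open coverings of $X$, quasi-ordered by refinement: $\mathcal U<\mathcal V$ if every member of $\mathcal V$ is contained in some member of $\mathcal U$. The nerve $\nu\mathcal U$ is the simplicial complex whose vertices are the nonempty members of $\mathcal U$ and whose $n$-simplices are the sets $\{U_0,\dots,U_n\}$ with $\bigcap_i U_i\ne\emptyset$; $|\nu\mathcal U|$ denotes its geometric realization. If $\mathcal U<\mathcal V$, a projection is a function $p\colon\mathcal V\to\mathcal U$ with $p(V)\supset V$ for all $V\in\mathcal V$. It induces a simplicial map $\nu\mathcal V\to\nu\mathcal U$ whose effect on homology does not depend on the choice of $p$. Then $\check H_k(X)$ is the inverse limit of the groups $H_k^{sing}(|\nu\mathcal U|)$, $\mathcal U\in Cov(X)$, along the maps $H_k^{sing}(p)$. Čech homology via neighbourhoods. $\check H_k^{\mathcal U}(X)$ is the inverse limit of the groups $H_k^{sing}(U)$, where $U$ runs over the open neighbourhoods of $X$ in $\mathrm E$ ordered by reverse inclusion, along the maps induced by inclusions. *)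

theory Defs
  imports "HOL-Analysis.Analysis" "HOL-Homology.Homology"
begin

section \<open>Inverse limits of groups\<close>

text \<open>The set \<open>F i j\<close> consists of the bonding maps from \<open>G j\<close> to \<open>G i\<close>. It is empty unless
  \<open>i\<close> precedes \<open>j\<close>. Having a set rather than one chosen map avoids selecting one of the many
  projections between two coverings.\<close>

definition inverse_limit ::
  "'i set \<Rightarrow> ('i \<Rightarrow> 'g monoid) \<Rightarrow> ('i \<Rightarrow> 'i \<Rightarrow> ('g \<Rightarrow> 'g) set) \<Rightarrow> ('i \<Rightarrow> 'g) monoid"
  where "inverse_limit I G F =
    (product_group I G)\<lparr>carrier :=
       {x \<in> carrier (product_group I G). \<forall>i\<in>I. \<forall>j\<in>I. \<forall>f\<in>F i j. f (x j) = x i}\<rparr>"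

lemma group_inverse_limit:
  assumes G: "\<And>i. i \<in> I \<Longrightarrow> group (G i)"
    and F: "\<And>i j f. i \<in> I \<Longrightarrow> j \<in> I \<Longrightarrow> f \<in> F i j \<Longrightarrow> f \<in> hom (G j) (G i)"
  shows "group (inverse_limit I G F)"
proof -
  let ?P = "product_group I G"
  let ?L = "{x \<in> carrier ?P. \<forall>i\<in>I. \<forall>j\<in>I. \<forall>f\<in>F i j. f (x j) = x i}"
  have P: "group ?P" using G by simp
  have "subgroup ?L ?P"
  proof (rule group.subgroupI [OF P])
    show "?L \<subseteq> carrier ?P" by blast
    have "f \<one>\<^bsub>G j\<^esub> = \<one>\<^bsub>G i\<^esub>" if "i \<in> I" "j \<in> I" "f \<in> F i j" for i j f
      using that by (intro hom_one F G)
    moreover have "\<one>\<^bsub>?P\<^esub> \<in> carrier ?P"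
      using group.is_monoid [OF P] by (rule monoid.one_closed)
    ultimately have "\<one>\<^bsub>?P\<^esub> \<in> ?L"
      by simp
    then show "?L \<noteq> {}" by blast
    show "inv\<^bsub>?P\<^esub> x \<in> ?L" if x: "x \<in> ?L" for x
    proof -
      have xc: "x \<in> carrier ?P" using x by blast
      then have xE: "x \<in> (\<Pi>\<^sub>E i\<in>I. carrier (G i))" by simp
      have "f ((inv\<^bsub>?P\<^esub> x) j) = (inv\<^bsub>?P\<^esub> x) i" if "i \<in> I" "j \<in> I" "f \<in> F i j" for i j f
      proof -
        interpret group_hom "G j" "G i" f
          using that F G by (simp add: group_hom_def group_hom_axioms_def)
        have "x j \<in> carrier (G j)" using xE that by blast
        moreover have "f (x j) = x i" using x that by blast
        ultimately show ?thesis
          using that inv_product_group [OF xE G] by simp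
      qed
      then show ?thesis using group.inv_closed [OF P xc] by blast
    qed
    show "x \<otimes>\<^bsub>?P\<^esub> y \<in> ?L" if x: "x \<in> ?L" and y: "y \<in> ?L" for x y
    proof -
      have xc: "x \<in> carrier ?P" "y \<in> carrier ?P" using x y by blast+
      have "f ((x \<otimes>\<^bsub>?P\<^esub> y) j) = (x \<otimes>\<^bsub>?P\<^esub> y) i" if "i \<in> I" "j \<in> I" "f \<in> F i j" for i j f
      proof -
        have "x j \<in> carrier (G j)" "y j \<in> carrier (G j)" using xc that by auto
        then have "f (x j \<otimes>\<^bsub>G j\<^esub> y j) = f (x j) \<otimes>\<^bsub>G i\<^esub> f (y j)"
          using hom_mult [OF F [OF that]] by blast
        then show ?thesis using x y that by simp
      qed
      moreover have "x \<otimes>\<^bsub>?P\<^esub> y \<in> carrier ?P"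
        using monoid.m_closed [OF group.is_monoid [OF P]] xc by blast
      ultimately show ?thesis by blast
    qed
  qed
  then show ?thesis
    unfolding inverse_limit_def using P group.subgroup_imp_group by blast
qed

section \<open>Geometric realization of an abstract simplicial complex\<close>

text \<open>A complex is given by the set \<open>K\<close> of its simplices, finite nonempty sets of vertices.
  Points are described by barycentric coordinates. The realization carries the weak topology,
  coherent with the closed simplices. This matters because coverings may be infinite.\<close>

definition geometric_simplex :: "'v set \<Rightarrow> ('v \<Rightarrow> real) set"
  where "geometric_simplex s = {t. (\<forall>v. 0 \<le> t v) \<and> (\<forall>v. v \<notin> s \<longrightarrow> t v = 0) \<and> sum t s = 1}"

definition geometric_realization :: "'v set set \<Rightarrow> ('v \<Rightarrow> real) topology"
  where "geometric_realization K = topology (\<lambda>T.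
     T \<subseteq> (\<Union>s\<in>K. geometric_simplex s) \<and>
     (\<forall>s\<in>K. openin (subtopology (powertop_real UNIV) (geometric_simplex s))
                    (T \<inter> geometric_simplex s)))"

lemma openin_geometric_realization:
  "openin (geometric_realization K) T \<longleftrightarrow>
     T \<subseteq> (\<Union>s\<in>K. geometric_simplex s) \<and>
     (\<forall>s\<in>K. openin (subtopology (powertop_real UNIV) (geometric_simplex s))
                    (T \<inter> geometric_simplex s))"
proof -
  let ?X = "\<lambda>s. subtopology (powertop_real UNIV) (geometric_simplex s)"
  let ?P = "\<lambda>T. T \<subseteq> (\<Union>s\<in>K. geometric_simplex s) \<and>
     (\<forall>s\<in>K. openin (?X s) (T \<inter> geometric_simplex s))"
  have "istopology ?P"
    unfolding istopology_def
  proof (intro conjI allI impI)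
    fix S T assume "?P S" "?P T"
    then show "S \<inter> T \<subseteq> (\<Union>s\<in>K. geometric_simplex s)" by blast
    show "\<forall>s\<in>K. openin (?X s) (S \<inter> T \<inter> geometric_simplex s)"
    proof
      fix s assume "s \<in> K"
      then have "openin (?X s) ((S \<inter> geometric_simplex s) \<inter> (T \<inter> geometric_simplex s))"
        using \<open>?P S\<close> \<open>?P T\<close> by blast
      then show "openin (?X s) (S \<inter> T \<inter> geometric_simplex s)"
        by (simp add: Int_ac)
    qed
  next
    fix \<K> assume K: "\<forall>T\<in>\<K>. ?P T"
    then show "\<Union>\<K> \<subseteq> (\<Union>s\<in>K. geometric_simplex s)" by blast
    show "\<forall>s\<in>K. openin (?X s) (\<Union>\<K> \<inter> geometric_simplex s)"
    proof
      fix s assume "s \<in> K"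
      then have "openin (?X s) (\<Union>T\<in>\<K>. T \<inter> geometric_simplex s)"
        using K by blast
      then show "openin (?X s) (\<Union>\<K> \<inter> geometric_simplex s)"
        by (simp only: Int_Union2)
    qed
  qed
  then show ?thesis
    by (simp add: geometric_realization_def topology_inverse')
qed

lemma topspace_geometric_realization:
  "topspace (geometric_realization K) = (\<Union>s\<in>K. geometric_simplex s)"
proof -
  have "openin (subtopology (powertop_real UNIV) (geometric_simplex s))
          ((\<Union>s\<in>K. geometric_simplex s) \<inter> geometric_simplex s)" if "s \<in> K" for s
  proof -
    have "(\<Union>s\<in>K. geometric_simplex s) \<inter> geometric_simplex s
        = topspace (subtopology (powertop_real UNIV) (geometric_simplex s))"
      using that by auto
    then show ?thesis by (metis openin_topspace)
  qed
  then have "openin (geometric_realization K) (\<Union>s\<in>K. geometric_simplex s)"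
    by (simp add: openin_geometric_realization)
  then show ?thesis
    by (meson openin_geometric_realization openin_subset openin_topspace subset_antisym)
qed

text \<open>The affine extension of a vertex map \<open>p\<close> to the realization. The index set of the sum is
  finite because a point of the realization has finite support.\<close>

definition realization_map :: "('v \<Rightarrow> 'w) \<Rightarrow> ('v \<Rightarrow> real) \<Rightarrow> 'w \<Rightarrow> real"
  where "realization_map p t = (\<lambda>w. \<Sum>v | t v \<noteq> 0 \<and> p v = w. t v)"

lemma realization_map_on_simplex:
  assumes "finite s" "t \<in> geometric_simplex s"
  shows "realization_map p t w = (\<Sum>v\<in>{v\<in>s. p v = w}. t v)"
  unfolding realization_map_def
  using assms by (intro sum.mono_neutral_left) (auto simp: geometric_simplex_def)

lemma realization_map_in_simplex:
  assumes "finite s" "t \<in> geometric_simplex s"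
  shows "realization_map p t \<in> geometric_simplex (p ` s)"
proof -
  have "sum (realization_map p t) (p ` s) = (\<Sum>w\<in>p ` s. \<Sum>v\<in>{v\<in>s. p v = w}. t v)"
    using assms by (simp add: realization_map_on_simplex)
  also have "\<dots> = sum t s"
    using assms by (intro sum.group) auto
  finally have "sum (realization_map p t) (p ` s) = 1"
    using assms by (simp add: geometric_simplex_def)
  moreover have "0 \<le> realization_map p t w" for w
    using assms by (simp add: realization_map_on_simplex)
                   (auto simp: geometric_simplex_def intro!: sum_nonneg)
  moreover have "realization_map p t w = 0" if "w \<notin> p ` s" for w
    using assms that by (subst realization_map_on_simplex) (auto intro!: sum.neutral)
  ultimately show ?thesis
    by (simp add: geometric_simplex_def)
qed

lemma continuous_map_realization_map:
  assumes fin: "\<And>s. s \<in> K \<Longrightarrow> finite s"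
    and simpl: "\<And>s. s \<in> K \<Longrightarrow> p ` s \<in> L"
  shows "continuous_map (geometric_realization K) (geometric_realization L) (realization_map p)"
proof -
  let ?X = "\<lambda>s. subtopology (powertop_real UNIV) (geometric_simplex s)"
  have cont: "continuous_map (?X s) (?X (p ` s)) (realization_map p)" if "s \<in> K" for s
  proof -
    have "continuous_map (?X s) euclideanreal (\<lambda>t. \<Sum>v\<in>{v\<in>s. p v = w}. t v)" for w
    proof (intro continuous_map_sum)
      show "finite {v \<in> s. p v = w}" using fin that by simp
      show "continuous_map (?X s) euclideanreal (\<lambda>t. t v)" for v
        by (intro continuous_map_from_subtopology continuous_map_product_projection) simp
    qed
    then have "continuous_map (?X s) euclideanreal (\<lambda>t. realization_map p t w)" for w
      by (rule continuous_map_eq [where f = "\<lambda>t. \<Sum>v\<in>{v\<in>s. p v = w}. t v"])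
         (simp add: realization_map_on_simplex [OF fin [OF that]])
    then have "continuous_map (?X s) (powertop_real UNIV) (realization_map p)"
      by (simp add: continuous_map_componentwise_UNIV)
    then show ?thesis
      by (auto simp: continuous_map_in_subtopology realization_map_in_simplex fin that)
  qed
  show ?thesis
    unfolding continuous_map_def
  proof (intro conjI allI impI)
    show "realization_map p \<in> topspace (geometric_realization K) \<rightarrow> topspace (geometric_realization L)"
      using fin simpl realization_map_in_simplex
      by (fastforce simp: topspace_geometric_realization)
    fix T assume T: "openin (geometric_realization L) T"
    let ?T = "{x \<in> topspace (geometric_realization K). realization_map p x \<in> T}"
    have "openin (?X s) (?T \<inter> geometric_simplex s)" if s: "s \<in> K" for s
    proof -
      have "openin (?X (p ` s)) (T \<inter> geometric_simplex (p ` s))"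
        using T s simpl by (simp add: openin_geometric_realization)
      then have "openin (?X s) {x \<in> topspace (?X s). realization_map p x \<in> T \<inter> geometric_simplex (p ` s)}"
        by (rule openin_continuous_map_preimage [OF cont [OF s]])
      moreover have "{x \<in> topspace (?X s). realization_map p x \<in> T \<inter> geometric_simplex (p ` s)}
          = ?T \<inter> geometric_simplex s"
        using s fin realization_map_in_simplex by (fastforce simp: topspace_geometric_realization)
      ultimately show ?thesis by simp
    qed
    then show "openin (geometric_realization K) ?T"
      by (simp add: openin_geometric_realization [of K ?T])
         (auto simp: topspace_geometric_realization)
  qed
qed

section \<open>Cech homology via coverings\<close>

definition open_coverings :: "'a topology \<Rightarrow> 'a set set set"
  where "open_coverings X = {\<U>. (\<forall>U\<in>\<U>. openin X U) \<and> \<Union>\<U> = topspace X}"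

definition refined_by :: "'a set set \<Rightarrow> 'a set set \<Rightarrow> bool"
  where "refined_by \<U> \<V> \<longleftrightarrow> (\<forall>V\<in>\<V>. \<exists>U\<in>\<U>. V \<subseteq> U)"

definition nerve :: "'a set set \<Rightarrow> 'a set set set"
  where "nerve \<U> = {s. finite s \<and> s \<noteq> {} \<and> s \<subseteq> \<U> - {{}} \<and> \<Inter>s \<noteq> {}}"

definition projections :: "'a set set \<Rightarrow> 'a set set \<Rightarrow> ('a set \<Rightarrow> 'a set) set"
  where "projections \<U> \<V> = {p. refined_by \<U> \<V> \<and> p \<in> \<V> \<rightarrow> \<U> \<and> (\<forall>V\<in>\<V>. V \<subseteq> p V)}"

lemma continuous_map_realization_projection:
  assumes "p \<in> projections \<U> \<V>"
  shows "continuous_map (geometric_realization (nerve \<V>)) (geometric_realization (nerve \<U>))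
           (realization_map p)"
proof (rule continuous_map_realization_map)
  show "finite s" if "s \<in> nerve \<V>" for s
    using that by (simp add: nerve_def)
  show "p ` s \<in> nerve \<U>" if s: "s \<in> nerve \<V>" for s
  proof -
    have sub: "V \<subseteq> p V" "p V \<in> \<U>" "V \<noteq> {}" if "V \<in> s" for V
      using s that assms by (auto simp: nerve_def projections_def)
    have "\<Inter>s \<subseteq> \<Inter>(p ` s)" using sub by blast
    moreover have "finite (p ` s)" "p ` s \<noteq> {}" "\<Inter>s \<noteq> {}"
      using s by (auto simp: nerve_def)
    moreover have "p ` s \<subseteq> \<U> - {{}}" using sub by blast
    ultimately show ?thesis unfolding nerve_def by blast
  qed
qed

definition cech_homology :: "nat \<Rightarrow> 'a topology \<Rightarrow> ('a set set \<Rightarrow> ('a set \<Rightarrow> real) chain set) monoid"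
  where "cech_homology k X =
    inverse_limit (open_coverings X)
      (\<lambda>\<U>. homology_group (int k) (geometric_realization (nerve \<U>)))
      (\<lambda>\<U> \<V>. {hom_induced (int k) (geometric_realization (nerve \<V>)) {}
                  (geometric_realization (nerve \<U>)) {} (realization_map p) | p.
                p \<in> projections \<U> \<V>})"

lemma group_cech_homology: "group (cech_homology k X)"
  unfolding cech_homology_def
  by (rule group_inverse_limit) (auto simp: hom_induced_hom)

section \<open>Cech homology via neighbourhoods\<close>

definition open_neighbourhoods :: "'a topology \<Rightarrow> 'a set \<Rightarrow> 'a set set"
  where "open_neighbourhoods E X = {U. openin E U \<and> X \<subseteq> U}"

definition cech_homology_nbhd :: "nat \<Rightarrow> 'a topology \<Rightarrow> 'a set \<Rightarrow> ('a set \<Rightarrow> 'a chain set) monoid"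
  where "cech_homology_nbhd k E X =
    inverse_limit (open_neighbourhoods E X)
      (\<lambda>U. homology_group (int k) (subtopology E U))
      (\<lambda>U V. if V \<subseteq> U
             then {hom_induced (int k) (subtopology E V) {} (subtopology E U) {} id} else {})"

lemma group_cech_homology_nbhd: "group (cech_homology_nbhd k E X)"
  unfolding cech_homology_nbhd_def
  by (rule group_inverse_limit) (auto simp: hom_induced_hom split: if_splits)

end

(*
  Embed E in Euclidean space by e and let r be a retraction of an open neighbourhood of e(E),
  composed with the inverse of e. Write N_eps for the set of points of E at distance less than eps
  from X.

  For every open covering U of X and small eps, a partition of unity gives a map
  phi : N_eps -> |nerve U| such that every vertex carrying weight at z contains all points of X
  within eps of z. For every open neighbourhood W of X and every sufficiently fine finite covering V
  of X, sending each vertex to a nearby point, extending affinely and applying r gives a map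
  psi : |nerve V| -> W. Straight-line homotopies, in the nerve respectively in Euclidean space
  followed by r, show that both maps are unique up to homotopy and compatible with projections and
  inclusions, that psi o phi is homotopic to an inclusion and that phi o psi is homotopic to a
  projection. So they induce mutually inverse maps of the inverse limits.

  The coverings are arbitrary, but phi only meets finitely many vertices and psi is only used for
  finite coverings, which are cofinal. Hence no homotopy has an infinite complex as its source, and
  the product of an infinite complex with the interval does not occur.
*)
theory Submission
  imports Defs
begin

section \<open>Inverse limits\<close>

lemma inverse_limit_compatible:
  assumes "x \<in> carrier (inverse_limit I G F)" "i \<in> I" "j \<in> I" "f \<in> F i j"
  shows "f (x j) = x i"
  using assms by (simp add: inverse_limit_def)

text \<open>Each coordinate of an image is computed from a single coordinate of the source, selected
  by \<open>\<alpha>\<close> or \<open>\<beta>\<close>. Naturality and inversion are demanded on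
  elements of the limits alone, so \<open>\<alpha>\<close> and \<open>\<beta>\<close> may be
  arbitrary, non-monotone choices. The inverse of a bijective homomorphism is one, so
  \<open>\<psi>\<close> only has to land in the carriers.\<close>

lemma inverse_limit_iso:
  assumes \<alpha>: "\<And>j. j \<in> J \<Longrightarrow> \<alpha> j \<in> I"
    and \<beta>: "\<And>i. i \<in> I \<Longrightarrow> \<beta> i \<in> J"
    and hom: "\<And>j. j \<in> J \<Longrightarrow> \<phi> j \<in> hom (G (\<alpha> j)) (H j)"
    and carr: "\<And>i y. i \<in> I \<Longrightarrow> y \<in> carrier (H (\<beta> i)) \<Longrightarrow> \<psi> i y \<in> carrier (G i)"
    and \<phi>: "\<And>x j j' f. x \<in> carrier (inverse_limit I G F) \<Longrightarrow> j \<in> J \<Longrightarrow> j' \<in> J \<Longrightarrow> f \<in> F' j j'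
        \<Longrightarrow> f (\<phi> j' (x (\<alpha> j'))) = \<phi> j (x (\<alpha> j))"
    and \<psi>: "\<And>y i i' f. y \<in> carrier (inverse_limit J H F') \<Longrightarrow> i \<in> I \<Longrightarrow> i' \<in> I \<Longrightarrow> f \<in> F i i'
        \<Longrightarrow> f (\<psi> i' (y (\<beta> i'))) = \<psi> i (y (\<beta> i))"
    and \<psi>\<phi>: "\<And>x i. x \<in> carrier (inverse_limit I G F) \<Longrightarrow> i \<in> I
        \<Longrightarrow> \<psi> i (\<phi> (\<beta> i) (x (\<alpha> (\<beta> i)))) = x i"
    and \<phi>\<psi>: "\<And>y j. y \<in> carrier (inverse_limit J H F') \<Longrightarrow> j \<in> J
        \<Longrightarrow> \<phi> j (\<psi> (\<alpha> j) (y (\<beta> (\<alpha> j)))) = y j"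
  shows "inverse_limit I G F \<cong> inverse_limit J H F'"
proof -
  let ?L = "inverse_limit I G F" and ?M = "inverse_limit J H F'"
  define \<Phi> where "\<Phi> = (\<lambda>x. \<lambda>j\<in>J. \<phi> j (x (\<alpha> j)))"
  define \<Psi> where "\<Psi> = (\<lambda>y. \<lambda>i\<in>I. \<psi> i (y (\<beta> i)))"
  have L: "x \<in> carrier ?L \<longleftrightarrow> x \<in> (\<Pi>\<^sub>E i\<in>I. carrier (G i)) \<and> (\<forall>i\<in>I. \<forall>j\<in>I. \<forall>f\<in>F i j. f (x j) = x i)" for x
    by (simp add: inverse_limit_def)
  have M: "y \<in> carrier ?M \<longleftrightarrow> y \<in> (\<Pi>\<^sub>E i\<in>J. carrier (H i)) \<and> (\<forall>i\<in>J. \<forall>j\<in>J. \<forall>f\<in>F' i j. f (y j) = y i)" for y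
    by (simp add: inverse_limit_def)
  have xG: "x i \<in> carrier (G i)" if "x \<in> carrier ?L" "i \<in> I" for x i
    using that L by blast
  have yH: "y j \<in> carrier (H j)" if "y \<in> carrier ?M" "j \<in> J" for y j
    using that M by blast
  have \<Phi>in: "\<Phi> x \<in> carrier ?M" if x: "x \<in> carrier ?L" for x
    unfolding M
    using \<phi> [OF x] hom_in_carrier [OF hom xG [OF x \<alpha>]] by (auto simp: \<Phi>_def)
  have \<Psi>in: "\<Psi> y \<in> carrier ?L" if y: "y \<in> carrier ?M" for y
    unfolding L
    using \<psi> [OF y] carr yH [OF y \<beta>] by (auto simp: \<Psi>_def)
  have "\<Phi> \<in> hom ?L ?M"
  proof (rule homI)
    fix x y assume "x \<in> carrier ?L" "y \<in> carrier ?L"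
    then have "\<phi> j (x (\<alpha> j) \<otimes>\<^bsub>G (\<alpha> j)\<^esub> y (\<alpha> j)) = \<phi> j (x (\<alpha> j)) \<otimes>\<^bsub>H j\<^esub> \<phi> j (y (\<alpha> j))" if "j \<in> J" for j
      using hom_mult [OF hom] xG \<alpha> that by blast
    then show "\<Phi> (x \<otimes>\<^bsub>?L\<^esub> y) = \<Phi> x \<otimes>\<^bsub>?M\<^esub> \<Phi> y"
      using \<alpha> by (auto simp: \<Phi>_def inverse_limit_def)
  qed (rule \<Phi>in)
  moreover have "bij_betw \<Phi> (carrier ?L) (carrier ?M)"
  proof (rule bij_betw_byWitness [where f' = \<Psi>])
    show "\<forall>x\<in>carrier ?L. \<Psi> (\<Phi> x) = x"
    proof
      fix x assume x: "x \<in> carrier ?L"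
      \<comment> \<open>Elements of the product are \<open>undefined\<close> off the index set, and
        so are values of \<open>\<Psi>\<close>; agreement on \<open>I\<close> is therefore equality
        of functions.\<close>
      then have "x \<in> extensional I" by (auto simp: L PiE_def)
      then show "\<Psi> (\<Phi> x) = x"
        using \<psi>\<phi> [OF x] \<beta> by (auto simp: \<Psi>_def \<Phi>_def extensional_def)
    qed
    show "\<forall>y\<in>carrier ?M. \<Phi> (\<Psi> y) = y"
    proof
      fix y assume y: "y \<in> carrier ?M"
      then have "y \<in> extensional J" by (auto simp: M PiE_def)
      then show "\<Phi> (\<Psi> y) = y"
        using \<phi>\<psi> [OF y] \<alpha> by (auto simp: \<Psi>_def \<Phi>_def extensional_def)
    qed
  qed (use \<Phi>in \<Psi>in in blast)+
  ultimately show ?thesis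
    by (auto simp: is_iso_def iso_def)
qed

section \<open>Maps to and from nerves\<close>

text \<open>The weak topology is finer than the topology of pointwise convergence, because openness
  is tested on each simplex in the latter.\<close>

lemma continuous_map_realization_coordinate:
  "continuous_map (geometric_realization K) euclideanreal (\<lambda>t. t v)"
  unfolding continuous_map_def
proof (intro conjI allI impI)
  fix T :: "real set" assume T: "openin euclideanreal T"
  let ?T = "{t \<in> topspace (geometric_realization K). t v \<in> T}"
  have "openin (subtopology (powertop_real UNIV) (geometric_simplex s)) (?T \<inter> geometric_simplex s)"
    if "s \<in> K" for s
  proof -
    have "openin (powertop_real UNIV) {t \<in> topspace (powertop_real UNIV). (t::'a \<Rightarrow> real) v \<in> T}"
      by (rule openin_continuous_map_preimage [OF _ T])
         (use continuous_map_product_projection [of v UNIV "\<lambda>_. euclideanreal"] in simp)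
    moreover have "?T \<inter> geometric_simplex s
        = {t \<in> topspace (powertop_real UNIV). t v \<in> T} \<inter> geometric_simplex s"
      using that by (auto simp: topspace_geometric_realization)
    ultimately show ?thesis by (auto simp: openin_subtopology)
  qed
  then show "openin (geometric_realization K) ?T"
    unfolding openin_geometric_realization [of K ?T]
    by (auto simp: topspace_geometric_realization)
qed simp

text \<open>The finite set \<open>F\<close> confines the image to a finite subcomplex, so that continuity of the
  coordinates implies continuity for the weak topology.\<close>

definition nerve_map :: "'b topology \<Rightarrow> 'a set set \<Rightarrow> ('b \<Rightarrow> 'a set \<Rightarrow> real) \<Rightarrow> bool"
  where "nerve_map T \<U> f \<longleftrightarrow> (\<forall>v. continuous_map T euclideanreal (\<lambda>t. f t v)) \<and>
    (\<exists>F. finite F \<and> F \<subseteq> \<U> \<and>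
      (\<forall>t\<in>topspace T. (\<forall>v. 0 \<le> f t v) \<and> (\<forall>v. v \<notin> F \<longrightarrow> f t v = 0) \<and> sum (f t) F = 1 \<and>
         (\<exists>x. \<forall>v. f t v \<noteq> 0 \<longrightarrow> x \<in> v)))"

text \<open>The simplices with vertices in \<open>F\<close> are finite in number, and their
  preimages are closed and cover \<open>T\<close>. On each of them the weak topology can be replaced
  by the product topology, and the finite union of closed pieces is closed.\<close>

lemma nerve_map_continuous:
  assumes "nerve_map T \<U> f"
  shows "continuous_map T (geometric_realization (nerve \<U>)) f"
proof -
  obtain F where F: "finite F" "F \<subseteq> \<U>"
    and cont: "\<And>v. continuous_map T euclideanreal (\<lambda>t. f t v)"
    and nonneg: "\<And>t v. t \<in> topspace T \<Longrightarrow> 0 \<le> f t v"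
    and off: "\<And>t v. t \<in> topspace T \<Longrightarrow> v \<notin> F \<Longrightarrow> f t v = 0"
    and one: "\<And>t. t \<in> topspace T \<Longrightarrow> sum (f t) F = 1"
    and common: "\<And>t. t \<in> topspace T \<Longrightarrow> \<exists>x. \<forall>v. f t v \<noteq> 0 \<longrightarrow> x \<in> v"
    using assms unfolding nerve_map_def by metis
  let ?R = "geometric_realization (nerve \<U>)"
  \<comment> \<open>The support is a simplex: it is nonempty because the weights add up to 1, and
    the common point makes its intersection nonempty and keeps the empty set out of it.\<close>
  have carrier: "{v. f t v \<noteq> 0} \<in> nerve \<U> \<and> {v. f t v \<noteq> 0} \<subseteq> F \<and> f t \<in> geometric_simplex {v. f t v \<noteq> 0}"
    if t: "t \<in> topspace T" for t
  proof -
    have sub: "{v. f t v \<noteq> 0} \<subseteq> F" using off [OF t] by blast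
    have "sum (f t) {v. f t v \<noteq> 0} = 1"
      using one [OF t] sum.mono_neutral_left [OF F(1) sub, of "f t"] by auto
    moreover then have "{v. f t v \<noteq> 0} \<noteq> {}" by force
    ultimately show ?thesis
      using sub F common [OF t] nonneg [OF t]
      by (auto simp: nerve_def geometric_simplex_def intro: finite_subset)
  qed
  have contP: "continuous_map T (powertop_real UNIV) f"
    by (simp add: continuous_map_componentwise_UNIV cont)
  show ?thesis
    unfolding continuous_map_closedin
  proof (intro conjI allI impI)
    show "f \<in> topspace T \<rightarrow> topspace ?R"
      using carrier by (auto simp: topspace_geometric_realization)
    fix C assume C: "closedin ?R C"
    define S where "S = {s \<in> nerve \<U>. s \<subseteq> F}"
    define D where "D s = {t \<in> topspace T. f t \<in> geometric_simplex s \<inter> C}" for s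
    have "finite S" using F unfolding S_def by simp
    moreover have "closedin T (D s)" if s: "s \<in> S" for s
    proof -
      \<comment> \<open>Inside the simplex \<open>s\<close>, the set \<open>C\<close> is the
        complement of a set \<open>W\<close> open in the product topology, where coordinatewise
        continuity suffices.\<close>
      have "openin ?R (topspace ?R - C)" using C by blast
      then have "openin (subtopology (powertop_real UNIV) (geometric_simplex s))
          ((topspace ?R - C) \<inter> geometric_simplex s)"
        using s by (simp add: openin_geometric_realization S_def)
      then obtain W where W: "openin (powertop_real UNIV) W"
        and eq: "(topspace ?R - C) \<inter> geometric_simplex s = W \<inter> geometric_simplex s"
        by (auto simp: openin_subtopology)
      \<comment> \<open>Nonnegative weights vanish off \<open>s\<close> exactly when their sum over
        \<open>F - s\<close> is 0. This makes lying in the simplex a closed condition on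
        \<open>t\<close>.\<close>
      have in_s: "f t \<in> geometric_simplex s \<longleftrightarrow> sum (f t) (F - s) \<in> {0}" if t: "t \<in> topspace T" for t
      proof -
        have "finite (F - s)" "s \<subseteq> F" using F s by (auto simp: S_def)
        then have "sum (f t) F = sum (f t) s + sum (f t) (F - s)"
          using F by (metis sum.subset_diff add.commute)
        moreover have "sum (f t) (F - s) = 0 \<longleftrightarrow> (\<forall>v\<in>F - s. f t v = 0)"
          using \<open>finite (F - s)\<close> nonneg [OF t] by (intro sum_nonneg_eq_0_iff) auto
        ultimately show ?thesis
          using nonneg [OF t] off [OF t] one [OF t] by (auto simp: geometric_simplex_def)
      qed
      have "closedin T {t \<in> topspace T. sum (f t) (F - s) \<in> {0}}"
        by (rule closedin_continuous_map_preimage [where Y = euclideanreal])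
           (use F cont in \<open>auto intro!: continuous_map_sum\<close>)
      moreover have "openin T {t \<in> topspace T. f t \<in> W}"
        by (rule openin_continuous_map_preimage [OF contP W])
      ultimately have "closedin T ({t \<in> topspace T. sum (f t) (F - s) \<in> {0}} - {t \<in> topspace T. f t \<in> W})"
        by (rule closedin_diff)
      moreover have "D s = {t \<in> topspace T. sum (f t) (F - s) \<in> {0}} - {t \<in> topspace T. f t \<in> W}"
      proof -
        have "s \<in> nerve \<U>" using s by (simp add: S_def)
        then have "geometric_simplex s \<subseteq> topspace ?R"
          by (auto simp: topspace_geometric_realization)
        then show ?thesis
          using eq in_s unfolding D_def by blast
      qed
      ultimately show ?thesis by simp
    qed
    ultimately have "closedin T (\<Union>s\<in>S. D s)" by (intro closedin_Union) auto
    moreover have "(\<Union>s\<in>S. D s) = {t \<in> topspace T. f t \<in> C}"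
      using carrier unfolding S_def D_def by blast
    ultimately show "closedin T {t \<in> topspace T. f t \<in> C}" by simp
  qed
qed

text \<open>The common point makes the two supports at \<open>t\<close> span one simplex, which
  contains the segment between \<open>f t\<close> and \<open>g t\<close>. The straight-line homotopy
  is itself a \<open>nerve_map\<close>, on the cylinder over \<open>T\<close> and with finite set
  \<open>F \<union> G\<close>, so its continuity needs no new argument.\<close>

lemma nerve_map_homotopic:
  assumes f: "nerve_map T \<U> f" and g: "nerve_map T \<U> g"
    and common: "\<And>t. t \<in> topspace T \<Longrightarrow> \<exists>x. \<forall>v. f t v \<noteq> 0 \<or> g t v \<noteq> 0 \<longrightarrow> x \<in> v"
  shows "homotopic_with (\<lambda>_. True) T (geometric_realization (nerve \<U>)) f g"
proof -
  obtain F where F: "finite F" "F \<subseteq> \<U>"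
    and contf: "\<And>v. continuous_map T euclideanreal (\<lambda>t. f t v)"
    and f: "\<And>t v. t \<in> topspace T \<Longrightarrow> 0 \<le> f t v"
      "\<And>t v. t \<in> topspace T \<Longrightarrow> v \<notin> F \<Longrightarrow> f t v = 0"
      "\<And>t. t \<in> topspace T \<Longrightarrow> sum (f t) F = 1"
    using f unfolding nerve_map_def by metis
  obtain G where G: "finite G" "G \<subseteq> \<U>"
    and contg: "\<And>v. continuous_map T euclideanreal (\<lambda>t. g t v)"
    and g: "\<And>t v. t \<in> topspace T \<Longrightarrow> 0 \<le> g t v"
      "\<And>t v. t \<in> topspace T \<Longrightarrow> v \<notin> G \<Longrightarrow> g t v = 0"
      "\<And>t. t \<in> topspace T \<Longrightarrow> sum (g t) G = 1"
    using g unfolding nerve_map_def by metis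
  let ?P = "prod_topology (top_of_set {0..1::real}) T"
  define h where "h = (\<lambda>z v. (1 - fst z) * f (snd z) v + fst z * g (snd z) v)"
  have "nerve_map ?P \<U> h"
    unfolding nerve_map_def
  proof (intro conjI exI [of _ "F \<union> G"] allI ballI impI)
    show "continuous_map ?P euclideanreal (\<lambda>z. h z v)" for v
    proof -
      have "continuous_map ?P euclideanreal fst"
        using continuous_map_fst [of "top_of_set {0..1}" T]
        unfolding continuous_map_in_subtopology by blast
      moreover have "continuous_map ?P euclideanreal (\<lambda>z. f (snd z) v)"
        "continuous_map ?P euclideanreal (\<lambda>z. g (snd z) v)"
        using continuous_map_compose [OF continuous_map_snd contf]
          continuous_map_compose [OF continuous_map_snd contg] by (auto simp: o_def)
      ultimately show ?thesis
        unfolding h_def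
        by (intro continuous_map_add continuous_map_real_mult continuous_map_diff) auto
    qed
    show "finite (F \<union> G)" "F \<union> G \<subseteq> \<U>" using F G by auto
    fix z assume z: "z \<in> topspace ?P"
    then have t: "snd z \<in> topspace T" and s: "0 \<le> fst z" "fst z \<le> 1" by auto
    show "0 \<le> h z v" for v using s f(1) [OF t] g(1) [OF t] by (simp add: h_def)
    show "h z v = 0" if "v \<notin> F \<union> G" for v using that f(2) [OF t] g(2) [OF t] by (simp add: h_def)
    have "sum (f (snd z)) (F \<union> G) = 1"
      using f(2,3) [OF t] F G sum.mono_neutral_left [of "F \<union> G" F "f (snd z)"] by simp
    moreover have "sum (g (snd z)) (F \<union> G) = 1"
      using g(2,3) [OF t] F G sum.mono_neutral_left [of "F \<union> G" G "g (snd z)"] by simp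
    ultimately show "sum (h z) (F \<union> G) = 1"
      unfolding h_def sum.distrib sum_distrib_left [symmetric] by simp
    have "f (snd z) v \<noteq> 0 \<or> g (snd z) v \<noteq> 0" if "h z v \<noteq> 0" for v
      using that by (auto simp: h_def)
    then show "\<exists>x. \<forall>v. h z v \<noteq> 0 \<longrightarrow> x \<in> v"
      using common [OF t] by blast
  qed
  then have "continuous_map ?P (geometric_realization (nerve \<U>)) h"
    by (rule nerve_map_continuous)
  then show ?thesis
    unfolding homotopic_with_def by (intro exI [of _ h]) (auto simp: h_def)
qed

lemma nerve_map_compose:
  assumes "nerve_map T \<U> f" "continuous_map S T g"
  shows "nerve_map S \<U> (f \<circ> g)"
proof -
  have "continuous_map S euclideanreal (\<lambda>t. (f \<circ> g) t v)" for v
    using assms continuous_map_compose [of S T g euclideanreal "\<lambda>t. f t v"]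
    by (simp add: nerve_map_def o_def)
  moreover have "g t \<in> topspace T" if "t \<in> topspace S" for t
    using assms that continuous_map_image_subset_topspace by blast
  ultimately show ?thesis
    using assms(1) unfolding nerve_map_def o_def by metis
qed

lemma realization_map_support:
  assumes "realization_map p t w \<noteq> 0"
  obtains v where "t v \<noteq> 0" "p v = w"
  using assms unfolding realization_map_def by (metis (mono_tags, lifting) mem_Collect_eq sum.neutral)

text \<open>A projection enlarges each member, so a common point of the vertices in a support stays
  common to their images.\<close>

lemma nerve_map_projection:
  assumes f: "nerve_map T \<V> f" and p: "p \<in> projections \<U> \<V>"
  shows "nerve_map T \<U> (realization_map p \<circ> f)"
proof -
  obtain F where F: "finite F" "F \<subseteq> \<V>"
    and cont: "\<And>v. continuous_map T euclideanreal (\<lambda>t. f t v)"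
    and f: "\<And>t v. t \<in> topspace T \<Longrightarrow> 0 \<le> f t v"
      "\<And>t v. t \<in> topspace T \<Longrightarrow> v \<notin> F \<Longrightarrow> f t v = 0"
      "\<And>t. t \<in> topspace T \<Longrightarrow> sum (f t) F = 1"
      "\<And>t. t \<in> topspace T \<Longrightarrow> \<exists>x. \<forall>v. f t v \<noteq> 0 \<longrightarrow> x \<in> v"
    using f unfolding nerve_map_def by metis
  have simplex: "f t \<in> geometric_simplex F" if "t \<in> topspace T" for t
    using f that by (auto simp: geometric_simplex_def)
  note on_F = realization_map_on_simplex [OF F(1) simplex]
  note in_F = realization_map_in_simplex [OF F(1) simplex]
  show ?thesis
    unfolding nerve_map_def
  proof (intro conjI exI [of _ "p ` F"] allI ballI impI)
    \<comment> \<open>The index set of the sum in \<open>realization_map\<close> varies with the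
      point; over \<open>F\<close> it becomes a fixed finite sum.\<close>
    show "continuous_map T euclideanreal (\<lambda>t. (realization_map p \<circ> f) t w)" for w
      by (rule continuous_map_eq [where f = "\<lambda>t. \<Sum>v\<in>{v\<in>F. p v = w}. f t v"])
         (use F cont in \<open>auto simp: on_F intro!: continuous_map_sum\<close>)
    show "finite (p ` F)" using F by simp
    show "p ` F \<subseteq> \<U>" using F p by (auto simp: projections_def)
    fix t assume t: "t \<in> topspace T"
    show "0 \<le> (realization_map p \<circ> f) t w" for w
      using in_F [OF t, of p] by (simp add: geometric_simplex_def)
    show "(realization_map p \<circ> f) t w = 0" if "w \<notin> p ` F" for w
      using in_F [OF t, of p] that by (simp add: geometric_simplex_def)
    show "sum ((realization_map p \<circ> f) t) (p ` F) = 1"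
      using in_F [OF t, of p] by (simp add: geometric_simplex_def)
    obtain x where x: "\<And>v. f t v \<noteq> 0 \<Longrightarrow> x \<in> v" using f(4) [OF t] by blast
    have "x \<in> w" if "(realization_map p \<circ> f) t w \<noteq> 0" for w
    proof -
      obtain v where v: "f t v \<noteq> 0" "p v = w"
        using \<open>(realization_map p \<circ> f) t w \<noteq> 0\<close> by (auto elim: realization_map_support)
      then have "v \<in> \<V>" using f(2) [OF t] F by blast
      then show ?thesis using x [OF v(1)] v(2) p by (auto simp: projections_def)
    qed
    then show "\<exists>x. \<forall>w. (realization_map p \<circ> f) t w \<noteq> 0 \<longrightarrow> x \<in> w" by blast
  qed
qed

section \<open>Points of a realized nerve, and refinements\<close>

text \<open>Each simplex of the nerve is a face of the full simplex on \<open>\<U>\<close>, which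
  need not belong to the nerve. Sums of barycentric coordinates may then run over all of
  \<open>\<U>\<close>.\<close>

lemma geometric_realization_nerve_subset:
  assumes "finite \<U>"
  shows "topspace (geometric_realization (nerve \<U>)) \<subseteq> geometric_simplex \<U>"
proof
  fix t assume "t \<in> topspace (geometric_realization (nerve \<U>))"
  then obtain s where s: "s \<in> nerve \<U>" "t \<in> geometric_simplex s"
    by (auto simp: topspace_geometric_realization)
  then have sub: "s \<subseteq> \<U>" by (auto simp: nerve_def)
  moreover have "sum t \<U> = 1"
    using s sub sum.mono_neutral_left [OF assms sub, of t] by (auto simp: geometric_simplex_def)
  ultimately show "t \<in> geometric_simplex \<U>"
    using s by (auto simp: geometric_simplex_def)
qed

text \<open>Any point in the intersection of a carrying simplex serves. It links a position in the
  nerve to a place in the covered space.\<close>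

lemma geometric_realization_nerve_common:
  assumes "t \<in> topspace (geometric_realization (nerve \<U>))"
  shows "\<exists>x\<in>\<Union>\<U>. \<forall>v. t v \<noteq> 0 \<longrightarrow> x \<in> v"
proof -
  obtain s where s: "s \<in> nerve \<U>" "t \<in> geometric_simplex s"
    using assms by (auto simp: topspace_geometric_realization)
  then have "s \<subseteq> \<U>" "s \<noteq> {}" "\<Inter>s \<noteq> {}" by (auto simp: nerve_def)
  then obtain x where "x \<in> \<Union>\<U>" "\<forall>v\<in>s. x \<in> v" by blast
  then show ?thesis using s(2) unfolding geometric_simplex_def by blast
qed

text \<open>A finite covering can itself play the part of the finite set. This lets realized
  projections enter contiguity arguments as nerve maps.\<close>

lemma nerve_map_id:
  assumes "finite \<U>"
  shows "nerve_map (geometric_realization (nerve \<U>)) \<U> id"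
  unfolding nerve_map_def
proof (intro conjI exI [of _ \<U>] allI ballI)
  fix t assume t: "t \<in> topspace (geometric_realization (nerve \<U>))"
  then have "t \<in> geometric_simplex \<U>"
    using geometric_realization_nerve_subset [OF assms] by blast
  then show "0 \<le> id t v" "v \<notin> \<U> \<longrightarrow> id t v = 0" "sum (id t) \<U> = 1" for v
    by (simp_all add: geometric_simplex_def)
  show "\<exists>x. \<forall>v. id t v \<noteq> 0 \<longrightarrow> x \<in> v"
    using geometric_realization_nerve_common [OF t] by auto
qed (use assms continuous_map_realization_coordinate in auto)

lemma nerve_map_support:
  assumes "nerve_map T \<U> f" "t \<in> topspace T" "f t v \<noteq> 0"
  shows "v \<in> \<U>"
proof -
  obtain F where "F \<subseteq> \<U>" "\<forall>v. v \<notin> F \<longrightarrow> f t v = 0"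
    using assms(1,2) unfolding nerve_map_def by blast
  then show ?thesis using assms(3) by blast
qed

lemma projection_exists:
  assumes "refined_by \<U> \<V>"
  obtains p where "p \<in> projections \<U> \<V>"
proof -
  have "\<exists>p. \<forall>V\<in>\<V>. p V \<in> \<U> \<and> V \<subseteq> p V"
    using assms unfolding refined_by_def by (intro bchoice) blast
  then show ?thesis using assms that unfolding projections_def by blast
qed

lemma refined_by_trans: "refined_by \<U> \<V> \<Longrightarrow> refined_by \<V> \<W> \<Longrightarrow> refined_by \<U> \<W>"
  unfolding refined_by_def by (meson subset_trans)

lemma common_refinement:
  assumes "\<U> \<in> open_coverings X" "\<V> \<in> open_coverings X"
  obtains \<W> where "\<W> \<in> open_coverings X" "refined_by \<U> \<W>" "refined_by \<V> \<W>"
proof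
  let ?W = "{U \<inter> V |U V. U \<in> \<U> \<and> V \<in> \<V>}"
  have "\<Union>?W = \<Union>\<U> \<inter> \<Union>\<V>" by blast
  then show "?W \<in> open_coverings X"
    using assms by (auto simp: open_coverings_def)
  show "refined_by \<U> ?W" "refined_by \<V> ?W"
    unfolding refined_by_def by blast+
qed

section \<open>Affine extension of vertex maps\<close>

text \<open>The affine extension of the vertex map \<open>a\<close>. The sum runs over all of
  \<open>\<V>\<close> instead of the support, so the index set does not depend on the point; it is
  meant for finite \<open>\<V>\<close>, the value being 0 otherwise.\<close>

definition barycentre :: "'v set \<Rightarrow> ('v \<Rightarrow> 'b::real_normed_vector) \<Rightarrow> ('v \<Rightarrow> real) \<Rightarrow> 'b"
  where "barycentre \<V> a t = (\<Sum>v\<in>\<V>. t v *\<^sub>R a v)"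

lemma continuous_map_barycentre:
  "continuous_map (geometric_realization K) euclidean (barycentre \<V> a)"
proof -
  have "((\<lambda>t. t v) \<longlongrightarrow> t v) (atin (geometric_realization K) t)"
    if "t \<in> topspace (geometric_realization K)" for t v
    using continuous_map_realization_coordinate [of K v] that
    unfolding continuous_map_atin limitin_canonical_iff by blast
  then show ?thesis
    unfolding continuous_map_atin barycentre_def by (auto intro!: tendsto_intros)
qed

text \<open>Balls are convex, and centres of weight 0, which may lie far away, drop out of the
  sum.\<close>

lemma dist_barycentre_less:
  fixes a :: "'v \<Rightarrow> 'b::real_normed_vector"
  assumes "finite \<V>" "\<And>v. 0 \<le> t v" "sum t \<V> = 1"
    and near: "\<And>v. v \<in> \<V> \<Longrightarrow> t v \<noteq> 0 \<Longrightarrow> dist p (a v) < \<delta>"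
  shows "dist p (barycentre \<V> a t) < \<delta>"
proof -
  let ?S = "{v \<in> \<V>. t v \<noteq> 0}"
  have "sum t ?S = sum t \<V>"
    using assms(1) by (intro sum.mono_neutral_left) auto
  then have "(\<Sum>v\<in>?S. t v *\<^sub>R a v) \<in> ball p \<delta>"
  proof (intro convex_sum)
    show "a v \<in> ball p \<delta>" if "v \<in> ?S" for v using near that by simp
  qed (simp_all add: assms(1,2,3))
  moreover have "(\<Sum>v\<in>?S. t v *\<^sub>R a v) = barycentre \<V> a t"
    unfolding barycentre_def using assms(1) by (intro sum.mono_neutral_left) auto
  ultimately show ?thesis by simp
qed

text \<open>The sum over \<open>\<W>\<close> is grouped along the fibres of \<open>q\<close>. Affine
  extension thus commutes with projections strictly, not merely up to homotopy.\<close>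

lemma barycentre_realization_map:
  assumes "finite \<V>" "finite \<W>" and q: "q \<in> projections \<V> \<W>"
    and t: "t \<in> topspace (geometric_realization (nerve \<W>))"
  shows "barycentre \<V> a (realization_map q t) = barycentre \<W> (a \<circ> q) t"
proof -
  have "t \<in> geometric_simplex \<W>"
    using geometric_realization_nerve_subset [OF \<open>finite \<W>\<close>] t by blast
  then have "barycentre \<V> a (realization_map q t) = (\<Sum>V\<in>\<V>. \<Sum>W\<in>{W\<in>\<W>. q W = V}. t W *\<^sub>R a (q W))"
    unfolding barycentre_def using assms(2)
    by (auto simp: realization_map_on_simplex scaleR_sum_left intro!: sum.cong)
  also have "\<dots> = barycentre \<W> (a \<circ> q) t"
    using assms sum.group [of \<W> \<V> q "\<lambda>W. t W *\<^sub>R a (q W)"]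
    by (auto simp: barycentre_def projections_def)
  finally show ?thesis .
qed

section \<open>Compact subsets of a neighbourhood retract\<close>

text \<open>The embedding enters through its left inverse \<open>r\<close>, defined on an open set.
  Pulling open sets of \<open>E\<close> back along \<open>r\<close> transfers covering questions
  about \<open>X\<close> to Euclidean space.\<close>

locale compact_in_neighbourhood_retract =
  fixes E :: "'a topology" and X :: "'a set"
    and e :: "'a \<Rightarrow> 'b::euclidean_space" and O' :: "'b set" and r :: "'b \<Rightarrow> 'a"
  assumes compactin_X: "compactin E X"
    and cont_e: "continuous_map E euclidean e"
    and open_O: "open O'"
    and cont_r: "continuous_map (top_of_set O') E r"
    and e_in: "z \<in> topspace E \<Longrightarrow> e z \<in> O'"
    and r_e: "z \<in> topspace E \<Longrightarrow> r (e z) = z"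
begin

section \<open>Uniform radii from compactness\<close>

lemma X_subset: "X \<subseteq> topspace E"
  using compactin_X by (rule compactin_subset_topspace)

lemma compact_image: "compact (e ` X)"
  using image_compactin [OF compactin_X cont_e] by simp

text \<open>The Lebesgue number of an open cover of a Euclidean compact set. The three uniform radii
  below arise from different choices of \<open>\<G>\<close>.\<close>

lemma open_cover_of_image:
  assumes "\<And>G. G \<in> \<G> \<Longrightarrow> open G" and "\<And>x. x \<in> X \<Longrightarrow> e x \<in> \<Union>\<G>"
  shows "\<exists>\<delta>>0. \<forall>x\<in>X. \<exists>G\<in>\<G>. ball (e x) \<delta> \<subseteq> G"
proof -
  have "e ` X \<subseteq> \<Union>\<G>" using assms(2) by auto
  from Heine_Borel_lemma [OF compact_image this assms(1)]
  have "\<exists>\<delta>>0. \<forall>y\<in>e ` X. \<exists>G\<in>\<G>. ball y \<delta> \<subseteq> G" by metis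
  then show ?thesis by auto
qed

lemma open_preimage:
  assumes "openin E W"
  shows "open {w \<in> O'. r w \<in> W}"
  using openin_continuous_map_preimage [OF cont_r assms] open_O
  by (simp add: openin_open_eq)

definition nbhd :: "real \<Rightarrow> 'a set"
  where "nbhd \<epsilon> = {z \<in> topspace E. \<exists>x\<in>X. dist (e x) (e z) < \<epsilon>}"

lemma openin_ball: "openin E {z \<in> topspace E. dist p (e z) < \<epsilon>}"
  using openin_continuous_map_preimage [OF cont_e, of "ball p \<epsilon>"] by simp

lemma nbhd_mono: "\<epsilon> \<le> \<epsilon>' \<Longrightarrow> nbhd \<epsilon> \<subseteq> nbhd \<epsilon>'"
  unfolding nbhd_def by force

lemma nbhd_open_neighbourhood:
  assumes "0 < \<epsilon>"
  shows "nbhd \<epsilon> \<in> open_neighbourhoods E X"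
proof -
  have "nbhd \<epsilon> = (\<Union>x\<in>X. {z \<in> topspace E. dist (e x) (e z) < \<epsilon>})"
    unfolding nbhd_def by blast
  then have "openin E (nbhd \<epsilon>)"
    using openin_ball by auto
  moreover have "X \<subseteq> nbhd \<epsilon>"
    using assms X_subset unfolding nbhd_def by force
  ultimately show ?thesis by (simp add: open_neighbourhoods_def)
qed

text \<open>Room for straight-line homotopies: a segment within one ball of radius
  \<open>\<delta>\<close> about a point of the image of \<open>X\<close> stays in the domain of
  \<open>r\<close>, and \<open>r\<close> carries it into \<open>U\<close>.\<close>

definition tube :: "'a set \<Rightarrow> real \<Rightarrow> bool"
  where "tube U \<delta> \<longleftrightarrow> (\<forall>x\<in>X. \<forall>w. dist (e x) w < \<delta> \<longrightarrow> w \<in> O' \<and> r w \<in> U)"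

lemma tube_exists:
  assumes "U \<in> open_neighbourhoods E X"
  obtains \<delta> where "0 < \<delta>" "tube U \<delta>"
proof -
  let ?P = "{w \<in> O'. r w \<in> U}"
  have U: "openin E U" "X \<subseteq> U"
    using assms by (auto simp: open_neighbourhoods_def)
  have "e x \<in> \<Union>{?P}" if "x \<in> X" for x
  proof -
    have "x \<in> topspace E" "x \<in> U" using that X_subset U(2) by blast+
    then show ?thesis using e_in r_e by simp
  qed
  moreover have "open G" if "G \<in> {?P}" for G using that open_preimage [OF U(1)] by simp
  ultimately have "\<exists>\<delta>>0. \<forall>x\<in>X. \<exists>G\<in>{?P}. ball (e x) \<delta> \<subseteq> G"
    by (intro open_cover_of_image)
  then obtain \<delta> where \<delta>: "0 < \<delta>" "\<And>x. x \<in> X \<Longrightarrow> ball (e x) \<delta> \<subseteq> ?P"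
    by auto
  then have "tube U \<delta>"
    unfolding tube_def by (auto simp: subset_iff)
  then show ?thesis using that \<delta> by blast
qed

text \<open>Uniform continuity of \<open>r\<close> along the compact image of \<open>X\<close>. It
  is sharper than a tube for \<open>nbhd \<epsilon>\<close>: \<open>r w\<close> is close to the very
  point \<open>x\<close> that \<open>w\<close> was close to, which the comparison with a projection
  relies on.\<close>

lemma retraction_near_X:
  assumes "0 < \<epsilon>"
  obtains \<delta> where "0 < \<delta>"
    "\<And>x w. x \<in> X \<Longrightarrow> dist (e x) w < \<delta> \<Longrightarrow> w \<in> O' \<and> dist (e x) (e (r w)) < \<epsilon>"
proof -
  define P where "P p = {w \<in> O'. r w \<in> {z \<in> topspace E. dist (e p) (e z) < \<epsilon>/2}}" for p
  have "open (P p)" for p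
    unfolding P_def by (rule open_preimage [OF openin_ball])
  then have "open G" if "G \<in> P ` X" for G
    using that by blast
  moreover have "e x \<in> P x" if "x \<in> X" for x
  proof -
    have "x \<in> topspace E" using that X_subset by blast
    then show ?thesis using e_in r_e assms by (simp add: P_def)
  qed
  ultimately have "\<exists>\<delta>>0. \<forall>x\<in>X. \<exists>G\<in>P ` X. ball (e x) \<delta> \<subseteq> G"
    by (intro open_cover_of_image) blast+
  then obtain \<delta> where \<delta>: "0 < \<delta>" "\<And>x. x \<in> X \<Longrightarrow> \<exists>G\<in>P ` X. ball (e x) \<delta> \<subseteq> G"
    by blast
  show ?thesis
  proof (rule that [OF \<delta>(1)])
    fix x w assume x: "x \<in> X" and w: "dist (e x) w < \<delta>"
    then obtain p where p: "ball (e x) \<delta> \<subseteq> P p" using \<delta>(2) by blast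
    \<comment> \<open>One set \<open>P p\<close> contains both points and \<open>r\<close> returns
      \<open>e x\<close> to \<open>x\<close>, so \<open>e (r w)\<close> and \<open>e x\<close> are
      both within \<open>\<epsilon>/2\<close> of \<open>e p\<close>.\<close>
    have "w \<in> P p" "e x \<in> P p" using p w \<delta>(1) by auto
    then have "w \<in> O'" "dist (e p) (e (r w)) < \<epsilon>/2" "dist (e p) (e x) < \<epsilon>/2"
      using x X_subset r_e by (auto simp: P_def subset_iff)
    then show "w \<in> O' \<and> dist (e x) (e (r w)) < \<epsilon>"
      by (auto intro: dist_triangle_half_r)
  qed
qed

text \<open>Distances are measured through \<open>e\<close>. The members of \<open>\<U>\<close> are
  traces on \<open>X\<close> of open sets \<open>W\<close> of \<open>E\<close>, whose preimages
  under \<open>r\<close> are open in Euclidean space and cover the image of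
  \<open>X\<close>.\<close>

lemma lebesgue_number:
  assumes \<U>: "\<U> \<in> open_coverings (subtopology E X)"
  obtains \<epsilon> where "0 < \<epsilon>" "\<And>x. x \<in> X \<Longrightarrow> \<exists>U\<in>\<U>. \<forall>y\<in>X. dist (e x) (e y) < \<epsilon> \<longrightarrow> y \<in> U"
proof -
  let ?G = "{{w \<in> O'. r w \<in> W} |W. openin E W \<and> W \<inter> X \<in> \<U>}"
  have "open G" if "G \<in> ?G" for G using that open_preimage by blast
  moreover have "e x \<in> \<Union>?G" if x: "x \<in> X" for x
  proof -
    have "\<Union>\<U> = X"
      using \<U> X_subset by (auto simp: open_coverings_def)
    then obtain U where U: "x \<in> U" "U \<in> \<U>"
      using x by blast
    then obtain W where "openin E W" "U = W \<inter> X"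
      using \<U> by (auto simp: open_coverings_def openin_subtopology)
    moreover have "x \<in> topspace E" using x X_subset by blast
    ultimately have "e x \<in> {w \<in> O'. r w \<in> W}" "{w \<in> O'. r w \<in> W} \<in> ?G"
      using U e_in r_e by auto
    then show ?thesis by (rule UnionI [rotated])
  qed
  ultimately have "\<exists>\<epsilon>>0. \<forall>x\<in>X. \<exists>G\<in>?G. ball (e x) \<epsilon> \<subseteq> G"
    by (intro open_cover_of_image)
  then obtain \<epsilon> where \<epsilon>: "0 < \<epsilon>" "\<And>x. x \<in> X \<Longrightarrow> \<exists>G\<in>?G. ball (e x) \<epsilon> \<subseteq> G"
    by (elim exE conjE) (rule that, auto)
  show ?thesis
  proof (rule that [OF \<epsilon>(1)])
    fix x assume "x \<in> X"
    then obtain W where W: "W \<inter> X \<in> \<U>" "ball (e x) \<epsilon> \<subseteq> {w \<in> O'. r w \<in> W}"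
      using \<epsilon>(2) by blast
    then have "\<forall>y\<in>X. dist (e x) (e y) < \<epsilon> \<longrightarrow> y \<in> W \<inter> X"
      using X_subset r_e by (auto simp: subset_iff)
    then show "\<exists>U\<in>\<U>. \<forall>y\<in>X. dist (e x) (e y) < \<epsilon> \<longrightarrow> y \<in> U"
      using W(1) by blast
  qed
qed

lemma finite_net:
  assumes "0 < \<epsilon>"
  obtains N where "finite N" "N \<subseteq> X" "\<And>x. x \<in> X \<Longrightarrow> \<exists>n\<in>N. dist (e n) (e x) < \<epsilon>"
proof -
  have "e ` X \<subseteq> (\<Union>x\<in>X. ball (e x) \<epsilon>)" using assms by force
  then obtain N where "N \<subseteq> X" "finite N" "e ` X \<subseteq> (\<Union>x\<in>N. ball (e x) \<epsilon>)"
    using compactE_image [OF compact_image, of X "\<lambda>x. ball (e x) \<epsilon>"] by auto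
  then show ?thesis using that by (auto simp: image_subset_iff)
qed

section \<open>Canonical maps from neighbourhoods to nerves\<close>

text \<open>The last condition makes any two canonical maps contiguous: at \<open>z\<close>, all vertices of positive
  weight under either map contain every point of \<open>X\<close> within distance \<open>\<epsilon>\<close> of \<open>z\<close>.\<close>

definition canonical :: "'a set set \<Rightarrow> real \<Rightarrow> ('a \<Rightarrow> 'a set \<Rightarrow> real) \<Rightarrow> bool"
  where "canonical \<U> \<epsilon> \<phi> \<longleftrightarrow> nerve_map (subtopology E (nbhd \<epsilon>)) \<U> \<phi> \<and>
    (\<forall>z\<in>nbhd \<epsilon>. \<forall>w x. \<phi> z w \<noteq> 0 \<longrightarrow> x \<in> X \<longrightarrow> dist (e x) (e z) < \<epsilon> \<longrightarrow> x \<in> w)"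

lemma canonicalD:
  "canonical \<U> \<epsilon> \<phi> \<Longrightarrow> z \<in> nbhd \<epsilon> \<Longrightarrow> \<phi> z w \<noteq> 0 \<Longrightarrow> x \<in> X \<Longrightarrow> dist (e x) (e z) < \<epsilon> \<Longrightarrow> x \<in> w"
  unfolding canonical_def by blast

lemma topspace_nbhd [simp]: "topspace E \<inter> nbhd \<epsilon> = nbhd \<epsilon>"
  by (auto simp: nbhd_def)

text \<open>A partition of unity made of bumps around a finite net, each net point passing its
  weight to a member of \<open>\<U>\<close> that contains a large ball around it.\<close>

lemma canonical_exists:
  assumes \<U>: "\<U> \<in> open_coverings (subtopology E X)"
  obtains \<epsilon> \<phi> where "0 < \<epsilon>" "canonical \<U> \<epsilon> \<phi>"
proof -
  obtain \<epsilon>' where "0 < \<epsilon>'" and leb: "\<And>x. x \<in> X \<Longrightarrow> \<exists>U\<in>\<U>. \<forall>y\<in>X. dist (e x) (e y) < \<epsilon>' \<longrightarrow> y \<in> U"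
    using lebesgue_number [OF \<U>] by blast
  \<comment> \<open>If a bump of radius \<open>2 * \<epsilon>\<close> about \<open>n\<close> is
    positive at \<open>z\<close>, every \<open>x\<close> within \<open>\<epsilon>\<close> of
    \<open>z\<close> is within \<open>3 * \<epsilon>\<close> of \<open>n\<close>, hence in
    \<open>u n\<close>.\<close>
  define \<epsilon> where "\<epsilon> = \<epsilon>'/3"
  have \<epsilon>: "0 < \<epsilon>" "\<epsilon>' = 3 * \<epsilon>" using \<open>0 < \<epsilon>'\<close> by (auto simp: \<epsilon>_def)
  obtain N where N: "finite N" "N \<subseteq> X" "\<And>x. x \<in> X \<Longrightarrow> \<exists>n\<in>N. dist (e n) (e x) < \<epsilon>"
    using finite_net [OF \<epsilon>(1)] by blast
  obtain u where u: "\<And>n. n \<in> N \<Longrightarrow> u n \<in> \<U>"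
    "\<And>n y. n \<in> N \<Longrightarrow> y \<in> X \<Longrightarrow> dist (e n) (e y) < 3 * \<epsilon> \<Longrightarrow> y \<in> u n"
    using leb N(2) unfolding \<epsilon>(2) by (metis subsetD)
  let ?T = "subtopology E (nbhd \<epsilon>)"
  define bump where "bump n z = max 0 (2 * \<epsilon> - dist (e n) (e z))" for n z
  define total where "total z = (\<Sum>n\<in>N. bump n z)" for z
  \<comment> \<open>Several net points may choose the same member of \<open>\<U>\<close>; their
    weights are added.\<close>
  define \<phi> where "\<phi> z w = (\<Sum>n\<in>{n\<in>N. u n = w}. bump n z) / total z" for z w
  have total: "0 < total z" if z: "z \<in> nbhd \<epsilon>" for z
  proof -
    \<comment> \<open>A point of \<open>X\<close> within \<open>\<epsilon>\<close> of
      \<open>z\<close> and a net point within \<open>\<epsilon>\<close> of it put \<open>z\<close>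
      inside a bump of radius \<open>2 * \<epsilon>\<close>.\<close>
    obtain x where x: "x \<in> X" "dist (e x) (e z) < \<epsilon>" using z by (auto simp: nbhd_def)
    then obtain n where n: "n \<in> N" "dist (e n) (e x) < \<epsilon>" using N(3) by blast
    then have "0 < bump n z"
      using x dist_triangle [of "e n" "e z" "e x"] by (simp add: bump_def)
    then show ?thesis
      unfolding total_def using n N(1) by (intro sum_pos2) (auto simp: bump_def)
  qed
  have near: "x \<in> w" if z: "z \<in> nbhd \<epsilon>" "\<phi> z w \<noteq> 0" and x: "x \<in> X" "dist (e x) (e z) < \<epsilon>" for z w x
  proof -
    have "(\<Sum>n\<in>{n\<in>N. u n = w}. bump n z) \<noteq> 0" using z by (auto simp: \<phi>_def)
    then obtain n where n: "n \<in> N" "u n = w" "bump n z \<noteq> 0"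
      by (metis (mono_tags, lifting) mem_Collect_eq sum.neutral)
    then have "dist (e n) (e x) < 3 * \<epsilon>"
      using x dist_triangle2 [of "e n" "e x" "e z"] by (auto simp: bump_def max_def split: if_splits)
    then show ?thesis using u n x by blast
  qed
  have tends: "((\<lambda>z. bump n z) \<longlongrightarrow> bump n z) (atin ?T z)" if "z \<in> nbhd \<epsilon>" for n z
  proof -
    have "continuous_map ?T euclidean e"
      by (rule continuous_map_from_subtopology [OF cont_e])
    then have "(e \<longlongrightarrow> e z) (atin ?T z)"
      using that unfolding continuous_map_atin by simp
    then show ?thesis unfolding bump_def by (intro tendsto_intros)
  qed
  have "nerve_map ?T \<U> \<phi>"
    unfolding nerve_map_def
  proof (intro conjI exI [of _ "u ` N"] allI ballI impI)
    show "continuous_map ?T euclideanreal (\<lambda>z. \<phi> z w)" for w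
    proof -
      have "((\<lambda>z. \<phi> z w) \<longlongrightarrow> \<phi> z w) (atin ?T z)" if "z \<in> nbhd \<epsilon>" for z
        unfolding \<phi>_def using tends [OF that] total [OF that]
        by (intro tendsto_intros) (auto simp: total_def [abs_def] intro!: tendsto_intros)
      then show ?thesis unfolding continuous_map_atin by simp
    qed
    show "finite (u ` N)" "u ` N \<subseteq> \<U>" using N u by auto
    fix z assume "z \<in> topspace ?T"
    then have z: "z \<in> nbhd \<epsilon>" by simp
    show "0 \<le> \<phi> z w" for w
      unfolding \<phi>_def using total [OF z] by (intro divide_nonneg_pos sum_nonneg) (auto simp: bump_def)
    show "\<phi> z w = 0" if "w \<notin> u ` N" for w
    proof -
      have "{n\<in>N. u n = w} = {}" using that by blast
      then show ?thesis by (simp only: \<phi>_def sum.empty div_0)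
    qed
    have "sum (\<phi> z) (u ` N) = (\<Sum>w\<in>u ` N. \<Sum>n\<in>{n\<in>N. u n = w}. bump n z) / total z"
      by (simp add: \<phi>_def sum_divide_distrib)
    also have "\<dots> = total z / total z"
      using N(1) by (subst sum.group) (auto simp: total_def)
    finally show "sum (\<phi> z) (u ` N) = 1" using total [OF z] by simp
    obtain x where "x \<in> X" "dist (e x) (e z) < \<epsilon>" using z by (auto simp: nbhd_def)
    then show "\<exists>x. \<forall>w. \<phi> z w \<noteq> 0 \<longrightarrow> x \<in> w" using near z by blast
  qed
  then have "canonical \<U> \<epsilon> \<phi>" using near by (auto simp: canonical_def)
  then show ?thesis using that \<epsilon>(1) by blast
qed

text \<open>A smaller \<open>\<epsilon>\<close> cuts down both the domain and the points that the
  vertices have to contain.\<close>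

lemma canonical_mono:
  assumes \<phi>: "canonical \<U> \<epsilon> \<phi>" and "\<epsilon>' \<le> \<epsilon>"
  shows "canonical \<U> \<epsilon>' \<phi>"
proof -
  have sub: "nbhd \<epsilon>' \<subseteq> nbhd \<epsilon>" using assms by (intro nbhd_mono)
  then have "continuous_map (subtopology E (nbhd \<epsilon>')) (subtopology E (nbhd \<epsilon>)) id"
    by (simp add: continuous_map_from_subtopology_mono [OF continuous_map_id] continuous_map_in_subtopology
        continuous_map_from_subtopology subset_iff)
  then have "nerve_map (subtopology E (nbhd \<epsilon>')) \<U> (\<phi> \<circ> id)"
    using \<phi> unfolding canonical_def by (intro nerve_map_compose) auto
  moreover have "x \<in> w"
    if "z \<in> nbhd \<epsilon>'" "\<phi> z w \<noteq> 0" "x \<in> X" "dist (e x) (e z) < \<epsilon>'" for z w x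
    using canonicalD [OF \<phi>] that sub \<open>\<epsilon>' \<le> \<epsilon>\<close> by force
  ultimately show ?thesis
    unfolding canonical_def by auto
qed

lemma canonical_homotopic:
  assumes \<phi>: "canonical \<U> \<epsilon> \<phi>" and \<phi>': "canonical \<U> \<epsilon> \<phi>'"
  shows "homotopic_with (\<lambda>_. True) (subtopology E (nbhd \<epsilon>)) (geometric_realization (nerve \<U>)) \<phi> \<phi>'"
proof (rule nerve_map_homotopic)
  fix z assume "z \<in> topspace (subtopology E (nbhd \<epsilon>))"
  then have z: "z \<in> nbhd \<epsilon>" by simp
  then obtain x where "x \<in> X" "dist (e x) (e z) < \<epsilon>" by (auto simp: nbhd_def)
  then show "\<exists>x. \<forall>w. \<phi> z w \<noteq> 0 \<or> \<phi>' z w \<noteq> 0 \<longrightarrow> x \<in> w"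
    using canonicalD [OF \<phi> z] canonicalD [OF \<phi>' z] by blast
qed (use assms in \<open>auto simp: canonical_def\<close>)

text \<open>Vertices only grow under \<open>p\<close>. Compatibility of canonical maps with
  projections thereby reduces to their uniqueness up to homotopy.\<close>

lemma canonical_projection:
  assumes \<phi>: "canonical \<V> \<epsilon> \<phi>" and p: "p \<in> projections \<U> \<V>"
  shows "canonical \<U> \<epsilon> (realization_map p \<circ> \<phi>)"
proof -
  have map: "nerve_map (subtopology E (nbhd \<epsilon>)) \<V> \<phi>" using \<phi> by (simp add: canonical_def)
  have "x \<in> w"
    if z: "z \<in> nbhd \<epsilon>" and w: "(realization_map p \<circ> \<phi>) z w \<noteq> 0" and x: "x \<in> X" "dist (e x) (e z) < \<epsilon>"
    for z w x
  proof -
    obtain v where v: "\<phi> z v \<noteq> 0" "p v = w"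
      using w by (auto elim: realization_map_support)
    then have "x \<in> v" using canonicalD [OF \<phi> z] x by blast
    moreover have "v \<in> \<V>"
      using nerve_map_support [OF map _ v(1)] z by simp
    ultimately show ?thesis using p v(2) by (auto simp: projections_def)
  qed
  then show ?thesis
    using nerve_map_projection [OF map p] unfolding canonical_def by blast
qed

section \<open>Finite coverings with nearby centres\<close>

text \<open>The centre \<open>a V\<close> need not lie in \<open>e ` V\<close>. This keeps the notion stable under composing \<open>a\<close>
  with a projection from a finer covering.\<close>

definition centred :: "'a set set \<Rightarrow> real \<Rightarrow> ('a set \<Rightarrow> 'b) \<Rightarrow> bool"
  where "centred \<V> \<delta> a \<longleftrightarrow> finite \<V> \<and> \<V> \<in> open_coverings (subtopology E X) \<and>
    (\<forall>V\<in>\<V>. \<forall>x\<in>V. dist (e x) (a V) < \<delta>)"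

lemma centred_mono: "centred \<V> \<delta> a \<Longrightarrow> \<delta> \<le> \<delta>' \<Longrightarrow> centred \<V> \<delta>' a"
  unfolding centred_def by force

lemma centred_Union: "centred \<V> \<delta> a \<Longrightarrow> \<Union>\<V> = X"
  using X_subset by (auto simp: centred_def open_coverings_def)

text \<open>A member \<open>W\<close> lies in \<open>q W\<close>, so the centre of
  \<open>q W\<close> is near all of \<open>W\<close>.\<close>

lemma centred_projection:
  assumes "centred \<V> \<delta> a" "q \<in> projections \<V> \<W>" "\<W> \<in> open_coverings (subtopology E X)" "finite \<W>"
  shows "centred \<W> \<delta> (a \<circ> q)"
  using assms unfolding centred_def projections_def by (auto simp: subset_iff Pi_iff)

lemma centred_refinement:
  assumes \<U>: "\<U> \<in> open_coverings (subtopology E X)" and "0 < \<delta>"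
  obtains \<V> a where "centred \<V> \<delta> a" "refined_by \<U> \<V>"
proof -
  obtain \<epsilon> where "0 < \<epsilon>" and leb: "\<And>x. x \<in> X \<Longrightarrow> \<exists>U\<in>\<U>. \<forall>y\<in>X. dist (e x) (e y) < \<epsilon> \<longrightarrow> y \<in> U"
    using lebesgue_number [OF \<U>] by blast
  \<comment> \<open>Radius \<open>\<epsilon>\<close> makes the traces of balls refine
    \<open>\<U>\<close>, radius \<open>\<delta>\<close> keeps them close to their centres.\<close>
  then have "0 < min \<epsilon> \<delta>" using \<open>0 < \<delta>\<close> by simp
  then obtain N where N: "finite N" "N \<subseteq> X" "\<And>x. x \<in> X \<Longrightarrow> \<exists>n\<in>N. dist (e n) (e x) < min \<epsilon> \<delta>"
    using finite_net by blast
  define B where "B n = {x \<in> topspace E. dist (e n) (e x) < min \<epsilon> \<delta>} \<inter> X" for n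
  \<comment> \<open>Different net points may cut out the same set, so one of them is chosen as its
    centre.\<close>
  define a where "a V = e (SOME n. n \<in> N \<and> B n = V)" for V
  have a: "\<exists>n\<in>N. B n = V \<and> a V = e n" if "V \<in> B ` N" for V
  proof -
    have "\<exists>n. n \<in> N \<and> B n = V" using that by blast
    then have "(SOME n. n \<in> N \<and> B n = V) \<in> N \<and> B (SOME n. n \<in> N \<and> B n = V) = V"
      by (rule someI_ex)
    then show ?thesis unfolding a_def by blast
  qed
  have "openin (subtopology E X) (B n)" for n
    unfolding B_def openin_subtopology using openin_ball by blast
  moreover have "\<Union>(B ` N) = topspace (subtopology E X)"
    using N(3) X_subset unfolding B_def by fastforce
  ultimately have "B ` N \<in> open_coverings (subtopology E X)"
    by (auto simp: open_coverings_def)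
  moreover have "dist (e x) (a V) < \<delta>" if "V \<in> B ` N" "x \<in> V" for V x
    using a [OF that(1)] that(2) by (auto simp: B_def dist_commute)
  ultimately have "centred (B ` N) \<delta> a"
    using N(1) by (auto simp: centred_def)
  moreover have "refined_by \<U> (B ` N)"
    unfolding refined_by_def
  proof
    fix V assume "V \<in> B ` N"
    then obtain n where "n \<in> N" "V = B n" by blast
    then show "\<exists>U\<in>\<U>. V \<subseteq> U"
      using leb [of n] N(2) unfolding B_def by (metis (no_types, lifting) IntE mem_Collect_eq min_less_iff_conj subset_iff)
  qed
  ultimately show ?thesis using that by blast
qed

section \<open>Spread maps from nerves into neighbourhoods\<close>

text \<open>One point \<open>x\<close> close to both \<open>f s\<close> and \<open>g s\<close> puts
  the whole segment into a convex ball, where the tube condition applies.\<close>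

lemma tube_homotopic:
  assumes f: "continuous_map S euclidean f" and g: "continuous_map S euclidean g"
    and U: "tube U \<delta>"
    and near: "\<And>s. s \<in> topspace S \<Longrightarrow> \<exists>x\<in>X. dist (e x) (f s) < \<delta> \<and> dist (e x) (g s) < \<delta>"
  shows "homotopic_with (\<lambda>_. True) S (subtopology E U) (r \<circ> f) (r \<circ> g)"
proof -
  let ?P = "prod_topology (top_of_set {0..1::real}) S"
  define h where "h z = (1 - fst z) *\<^sub>R f (snd z) + fst z *\<^sub>R g (snd z)" for z
  have h_in: "h z \<in> O' \<and> r (h z) \<in> U" if z: "z \<in> topspace ?P" for z
  proof -
    obtain x where "x \<in> X" and x: "f (snd z) \<in> ball (e x) \<delta>" "g (snd z) \<in> ball (e x) \<delta>"
      using near [of "snd z"] z by auto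
    have "h z \<in> ball (e x) \<delta>"
      unfolding h_def using z by (intro convexD [OF convex_ball x]) auto
    then show ?thesis using U \<open>x \<in> X\<close> unfolding tube_def by simp
  qed
  have "continuous_map ?P euclidean h"
  proof -
    have "continuous_map ?P euclideanreal fst"
      using continuous_map_fst [of "top_of_set {0..1}" S]
      unfolding continuous_map_in_subtopology by blast
    moreover have "continuous_map ?P euclidean (\<lambda>z. f (snd z))"
      "continuous_map ?P euclidean (\<lambda>z. g (snd z))"
      using continuous_map_compose [OF continuous_map_snd f]
        continuous_map_compose [OF continuous_map_snd g] by (auto simp: o_def)
    ultimately show ?thesis
      unfolding h_def continuous_map_atin limitin_canonical_iff by (auto intro!: tendsto_intros)
  qed
  then have "continuous_map ?P (top_of_set O') h"
    using h_in by (simp add: continuous_map_in_subtopology)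
  then have "continuous_map ?P E (r \<circ> h)"
    using cont_r by (rule continuous_map_compose)
  then have "continuous_map ?P (subtopology E U) (r \<circ> h)"
    using h_in by (simp add: continuous_map_in_subtopology)
  then show ?thesis
    unfolding homotopic_with_def by (intro exI [of _ "r \<circ> h"]) (auto simp: h_def)
qed

text \<open>A common point \<open>x\<close> of the vertices in use is close to all of their centres,
  hence to any convex combination of them.\<close>

lemma barycentre_near:
  assumes "centred \<V> \<delta> a" "t \<in> topspace (geometric_realization (nerve \<V>))"
    "\<forall>v. t v \<noteq> 0 \<longrightarrow> x \<in> v"
  shows "dist (e x) (barycentre \<V> a t) < \<delta>"
proof (rule dist_barycentre_less)
  show "finite \<V>" using assms by (simp add: centred_def)
  then have "t \<in> geometric_simplex \<V>"
    using geometric_realization_nerve_subset assms(2) by blast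
  then show "sum t \<V> = 1" "\<And>v. 0 \<le> t v"
    by (auto simp: geometric_simplex_def)
  show "dist (e x) (a v) < \<delta>" if "v \<in> \<V>" "t v \<noteq> 0" for v
  proof -
    have "x \<in> v" using assms(3) that by simp
    then show ?thesis using assms(1) that by (simp add: centred_def)
  qed
qed

lemma centred_homotopic:
  assumes a: "centred \<V> \<delta> a" and b: "centred \<V> \<delta> b" and U: "tube U \<delta>"
  shows "homotopic_with (\<lambda>_. True) (geometric_realization (nerve \<V>)) (subtopology E U)
           (r \<circ> barycentre \<V> a) (r \<circ> barycentre \<V> b)"
proof (rule tube_homotopic [OF continuous_map_barycentre continuous_map_barycentre U])
  fix t assume t: "t \<in> topspace (geometric_realization (nerve \<V>))"
  obtain x where x: "x \<in> \<Union>\<V>" "\<forall>v. t v \<noteq> 0 \<longrightarrow> x \<in> v"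
    using geometric_realization_nerve_common [OF t] by (elim bexE)
  have "x \<in> X" using x(1) centred_Union [OF a] by simp
  then show "\<exists>x\<in>X. dist (e x) (barycentre \<V> a t) < \<delta> \<and> dist (e x) (barycentre \<V> b t) < \<delta>"
    using barycentre_near [OF a t x(2)] barycentre_near [OF b t x(2)] by (intro bexI [of _ x] conjI)
qed

text \<open>The homotopy of the map with itself already contains its continuity into
  \<open>subtopology E U\<close>.\<close>

lemma continuous_map_spread:
  assumes "centred \<V> \<delta> a" "tube U \<delta>"
  shows "continuous_map (geometric_realization (nerve \<V>)) (subtopology E U) (r \<circ> barycentre \<V> a)"
  using homotopic_with_imp_continuous_maps [OF centred_homotopic [OF assms(1,1,2)]] by (rule conjunct1)

section \<open>Comparison of the inverse limits\<close>

lemma nbhd_restriction: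
  assumes "y \<in> carrier (cech_homology_nbhd k E X)"
    and "U \<in> open_neighbourhoods E X" "V \<in> open_neighbourhoods E X" "V \<subseteq> U"
  shows "hom_induced (int k) (subtopology E V) {} (subtopology E U) {} id (y V) = y U"
  by (rule inverse_limit_compatible [OF assms(1) [unfolded cech_homology_nbhd_def] assms(2,3)])
     (simp only: assms(4) if_True singleton_iff)

lemma covering_projection:
  assumes "x \<in> carrier (cech_homology k (subtopology E X))"
    and "\<U> \<in> open_coverings (subtopology E X)" "\<V> \<in> open_coverings (subtopology E X)"
    and "p \<in> projections \<U> \<V>"
  shows "hom_induced (int k) (geometric_realization (nerve \<V>)) {} (geometric_realization (nerve \<U>)) {}
           (realization_map p) (x \<V>) = x \<U>"
  by (rule inverse_limit_compatible [OF assms(1) [unfolded cech_homology_def] assms(2,3)])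
     (use assms(4) in blast)

lemma spread_projection:
  assumes x: "x \<in> carrier (cech_homology k (subtopology E X))"
    and \<V>: "centred \<V> \<delta> a" and U: "tube U \<delta>"
    and \<W>: "\<W> \<in> open_coverings (subtopology E X)" "finite \<W>" and q: "q \<in> projections \<V> \<W>"
  shows "hom_induced (int k) (geometric_realization (nerve \<V>)) {} (subtopology E U) {}
           (r \<circ> barycentre \<V> a) (x \<V>)
       = hom_induced (int k) (geometric_realization (nerve \<W>)) {} (subtopology E U) {}
           (r \<circ> barycentre \<W> (a \<circ> q)) (x \<W>)"
proof -
  have fin: "finite \<V>" "\<V> \<in> open_coverings (subtopology E X)"
    using \<V> by (auto simp: centred_def)
  have "hom_induced (int k) (geometric_realization (nerve \<V>)) {} (subtopology E U) {}
      (r \<circ> barycentre \<V> a) (x \<V>)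
    = hom_induced (int k) (geometric_realization (nerve \<W>)) {} (subtopology E U) {}
      ((r \<circ> barycentre \<V> a) \<circ> realization_map q) (x \<W>)"
    \<comment> \<open>The coordinate at \<open>\<V>\<close> is rewritten as the projection of the
      one at \<open>\<W>\<close>.\<close>
    unfolding covering_projection [OF x fin(2) \<W>(1) q, symmetric]
    by (rule hom_induced_compose' [OF continuous_map_realization_projection [OF q] _
          continuous_map_spread [OF \<V> U]]) auto
  also have "\<dots> = hom_induced (int k) (geometric_realization (nerve \<W>)) {} (subtopology E U) {}
      (r \<circ> barycentre \<W> (a \<circ> q)) (x \<W>)"
    using barycentre_realization_map [OF fin(1) \<W>(2) q, of _ a]
    by (intro fun_cong [OF hom_induced_eq]) (simp only: o_apply)
  finally show ?thesis .
qed

text \<open>Both sides are moved to a common finite refinement, where the two pulled-back choices of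
  centres give homotopic maps.\<close>

lemma spread_independent:
  assumes x: "x \<in> carrier (cech_homology k (subtopology E X))"
    and \<V>: "centred \<V> \<delta> a" "tube U \<delta>"
    and \<V>': "centred \<V>' \<delta>' a'" "tube U \<delta>'"
  shows "hom_induced (int k) (geometric_realization (nerve \<V>)) {} (subtopology E U) {}
           (r \<circ> barycentre \<V> a) (x \<V>)
       = hom_induced (int k) (geometric_realization (nerve \<V>')) {} (subtopology E U) {}
           (r \<circ> barycentre \<V>' a') (x \<V>')"
proof -
  have "\<V> \<in> open_coverings (subtopology E X)" "\<V>' \<in> open_coverings (subtopology E X)"
    using \<V> \<V>' by (auto simp: centred_def)
  then obtain \<U> where \<U>: "\<U> \<in> open_coverings (subtopology E X)" "refined_by \<V> \<U>" "refined_by \<V>' \<U>"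
    by (rule common_refinement)
  \<comment> \<open>The radius 1 is arbitrary; finiteness and fineness of \<open>\<W>\<close> are
    what counts, and its centres \<open>b\<close> are discarded.\<close>
  obtain \<W> b where \<W>: "centred \<W> 1 b" "refined_by \<U> \<W>"
    using centred_refinement [OF \<U>(1), of 1] by auto
  have cov: "\<W> \<in> open_coverings (subtopology E X)" "finite \<W>"
    using \<W>(1) by (auto simp: centred_def)
  obtain q where q: "q \<in> projections \<V> \<W>"
    using projection_exists [OF refined_by_trans [OF \<U>(2) \<W>(2)]] by blast
  obtain q' where q': "q' \<in> projections \<V>' \<W>"
    using projection_exists [OF refined_by_trans [OF \<U>(3) \<W>(2)]] by blast
  \<comment> \<open>The maximum is one of the two radii, so it inherits a tube, while both systems
    of centres meet this weaker bound.\<close>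
  have "tube U (max \<delta> \<delta>')" using \<V>(2) \<V>'(2) by (simp add: max_def)
  moreover have "centred \<W> (max \<delta> \<delta>') (a \<circ> q)" "centred \<W> (max \<delta> \<delta>') (a' \<circ> q')"
    using centred_projection [OF \<V>(1) q cov] centred_projection [OF \<V>'(1) q' cov]
    by (auto elim: centred_mono)
  ultimately have "homotopic_with (\<lambda>_. True) (geometric_realization (nerve \<W>)) (subtopology E U)
      (r \<circ> barycentre \<W> (a \<circ> q)) (r \<circ> barycentre \<W> (a' \<circ> q'))"
    by (intro centred_homotopic)
  then show ?thesis
    unfolding spread_projection [OF x \<V> cov q] spread_projection [OF x \<V>' cov q']
    by (intro fun_cong [OF homology_homotopy_empty])
qed

section \<open>Canonical maps on elements of the neighbourhood limit\<close>

lemma canonical_continuous: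
  "canonical \<U> \<epsilon> \<phi> \<Longrightarrow> continuous_map (subtopology E (nbhd \<epsilon>)) (geometric_realization (nerve \<U>)) \<phi>"
  unfolding canonical_def by (blast intro: nerve_map_continuous)

lemma continuous_map_inclusion:
  "V \<subseteq> U \<Longrightarrow> continuous_map (subtopology E V) (subtopology E U) id"
  by (auto simp: continuous_map_in_subtopology intro: continuous_map_from_subtopology)

lemma canonical_restrict:
  assumes y: "y \<in> carrier (cech_homology_nbhd k E X)"
    and \<phi>: "canonical \<U> \<epsilon> \<phi>" and \<epsilon>: "0 < \<epsilon>'" "\<epsilon>' \<le> \<epsilon>"
  shows "hom_induced (int k) (subtopology E (nbhd \<epsilon>)) {} (geometric_realization (nerve \<U>)) {} \<phi> (y (nbhd \<epsilon>))
       = hom_induced (int k) (subtopology E (nbhd \<epsilon>')) {} (geometric_realization (nerve \<U>)) {} \<phi> (y (nbhd \<epsilon>'))"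
proof -
  have sub: "nbhd \<epsilon>' \<subseteq> nbhd \<epsilon>" using \<epsilon> by (intro nbhd_mono)
  have "hom_induced (int k) (subtopology E (nbhd \<epsilon>)) {} (geometric_realization (nerve \<U>)) {} \<phi>
        (hom_induced (int k) (subtopology E (nbhd \<epsilon>')) {} (subtopology E (nbhd \<epsilon>)) {} id (y (nbhd \<epsilon>')))
      = hom_induced (int k) (subtopology E (nbhd \<epsilon>')) {} (geometric_realization (nerve \<U>)) {} (\<phi> \<circ> id) (y (nbhd \<epsilon>'))"
    by (rule hom_induced_compose' [OF continuous_map_inclusion [OF sub] _ canonical_continuous [OF \<phi>]]) auto
  then show ?thesis
    using nbhd_restriction [OF y _ _ sub] nbhd_open_neighbourhood \<epsilon> by simp
qed

text \<open>Compatibility of \<open>y\<close> moves both sides to the smaller neighbourhood, where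
  the two canonical maps are homotopic.\<close>

lemma canonical_independent:
  assumes y: "y \<in> carrier (cech_homology_nbhd k E X)"
    and \<phi>: "canonical \<U> \<epsilon> \<phi>" "0 < \<epsilon>" and \<phi>': "canonical \<U> \<epsilon>' \<phi>'" "0 < \<epsilon>'"
  shows "hom_induced (int k) (subtopology E (nbhd \<epsilon>)) {} (geometric_realization (nerve \<U>)) {} \<phi> (y (nbhd \<epsilon>))
       = hom_induced (int k) (subtopology E (nbhd \<epsilon>')) {} (geometric_realization (nerve \<U>)) {} \<phi>' (y (nbhd \<epsilon>'))"
proof -
  let ?\<epsilon> = "min \<epsilon> \<epsilon>'"
  have "homotopic_with (\<lambda>_. True) (subtopology E (nbhd ?\<epsilon>)) (geometric_realization (nerve \<U>)) \<phi> \<phi>'"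
    using canonical_mono [OF \<phi>(1)] canonical_mono [OF \<phi>'(1)] by (intro canonical_homotopic) auto
  then have "hom_induced (int k) (subtopology E (nbhd ?\<epsilon>)) {} (geometric_realization (nerve \<U>)) {} \<phi>
    = hom_induced (int k) (subtopology E (nbhd ?\<epsilon>)) {} (geometric_realization (nerve \<U>)) {} \<phi>'"
    by (rule homology_homotopy_empty)
  then show ?thesis
    using canonical_restrict [OF y \<phi>(1), of ?\<epsilon>] canonical_restrict [OF y \<phi>'(1), of ?\<epsilon>] \<phi>(2) \<phi>'(2)
    by simp
qed

lemma tube_nbhd_subset:
  assumes "tube U \<delta>" "\<epsilon> \<le> \<delta>"
  shows "nbhd \<epsilon> \<subseteq> U"
proof
  fix z assume "z \<in> nbhd \<epsilon>"
  then obtain x where "z \<in> topspace E" "x \<in> X" "dist (e x) (e z) < \<epsilon>" by (auto simp: nbhd_def)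
  then have "r (e z) \<in> U" using assms unfolding tube_def by auto
  then show "z \<in> U" using r_e [OF \<open>z \<in> topspace E\<close>] by simp
qed

section \<open>The two composites\<close>

text \<open>On a small neighbourhood the composite is joined to the inclusion by \<open>r\<close>
  applied to the segment from \<open>barycentre \<V> a (\<phi> z)\<close> to \<open>e z\<close>: a
  point of \<open>X\<close> near \<open>z\<close> lies in every vertex of \<open>\<phi> z\<close>,
  so it is near both ends.\<close>

lemma spread_canonical:
  assumes y: "y \<in> carrier (cech_homology_nbhd k E X)" and U: "U \<in> open_neighbourhoods E X"
    and \<V>: "centred \<V> \<delta> a" and tube: "tube U \<delta>" and "0 < \<delta>"
    and \<phi>: "canonical \<V> \<epsilon> \<phi>" and "0 < \<epsilon>"
  shows "hom_induced (int k) (geometric_realization (nerve \<V>)) {} (subtopology E U) {} (r \<circ> barycentre \<V> a)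
    (hom_induced (int k) (subtopology E (nbhd \<epsilon>)) {} (geometric_realization (nerve \<V>)) {} \<phi> (y (nbhd \<epsilon>))) = y U"
proof -
  \<comment> \<open>The bound \<open>\<epsilon>\<close> is for \<open>\<phi>\<close> to be
    canonical, the bound \<open>\<delta>\<close> for \<open>e z\<close> to lie in the tube.\<close>
  define \<eta> where "\<eta> = min \<epsilon> \<delta>"
  have \<eta>: "0 < \<eta>" "\<eta> \<le> \<epsilon>" "\<eta> \<le> \<delta>" using assms by (auto simp: \<eta>_def)
  let ?S = "subtopology E (nbhd \<eta>)"
  have \<phi>': "canonical \<V> \<eta> \<phi>" using canonical_mono [OF \<phi> \<eta>(2)] .
  note cont = canonical_continuous [OF \<phi>']
  have "homotopic_with (\<lambda>_. True) ?S (subtopology E U) (r \<circ> (barycentre \<V> a \<circ> \<phi>)) (r \<circ> e)"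
  proof (rule tube_homotopic [OF _ _ tube])
    show "continuous_map ?S euclidean (barycentre \<V> a \<circ> \<phi>)"
      by (rule continuous_map_compose [OF cont continuous_map_barycentre])
    show "continuous_map ?S euclidean e"
      by (rule continuous_map_from_subtopology [OF cont_e])
    fix z assume "z \<in> topspace ?S"
    then have z: "z \<in> nbhd \<eta>" by simp
    then obtain x where x: "x \<in> X" "dist (e x) (e z) < \<eta>" by (auto simp: nbhd_def)
    have "\<phi> z \<in> topspace (geometric_realization (nerve \<V>))"
      using continuous_map_image_subset_topspace [OF cont] z by auto
    moreover have "\<forall>v. \<phi> z v \<noteq> 0 \<longrightarrow> x \<in> v"
      using canonicalD [OF \<phi>' z _ x] by blast
    ultimately have "dist (e x) (barycentre \<V> a (\<phi> z)) < \<delta>"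
      by (rule barycentre_near [OF \<V>])
    then show "\<exists>x\<in>X. dist (e x) ((barycentre \<V> a \<circ> \<phi>) z) < \<delta> \<and> dist (e x) (e z) < \<delta>"
      using x \<eta>(3) by (intro bexI [of _ x]) auto
  qed
  then have "hom_induced (int k) ?S {} (subtopology E U) {} ((r \<circ> barycentre \<V> a) \<circ> \<phi>)
      = hom_induced (int k) ?S {} (subtopology E U) {} (r \<circ> e)"
    unfolding o_assoc [symmetric] by (rule homology_homotopy_empty)
  also have "\<dots> = hom_induced (int k) ?S {} (subtopology E U) {} id"
    by (rule hom_induced_eq) (simp add: nbhd_def r_e)
  finally have "hom_induced (int k) (geometric_realization (nerve \<V>)) {} (subtopology E U) {} (r \<circ> barycentre \<V> a)
      (hom_induced (int k) ?S {} (geometric_realization (nerve \<V>)) {} \<phi> (y (nbhd \<eta>)))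
    = hom_induced (int k) ?S {} (subtopology E U) {} id (y (nbhd \<eta>))"
    using hom_induced_compose' [OF cont _ continuous_map_spread [OF \<V> tube]] by simp
  also have "\<dots> = y U"
    by (rule nbhd_restriction [OF y U nbhd_open_neighbourhood [OF \<eta>(1)] tube_nbhd_subset [OF tube \<eta>(3)]])
  finally show ?thesis
    using canonical_restrict [OF y \<phi> \<eta>(1,2)] by simp
qed

text \<open>The given \<open>\<V>\<close> need not refine \<open>\<U>\<close>, nor
  \<open>\<delta>\<close> control how far \<open>r\<close> moves points. Both are arranged for an
  auxiliary covering \<open>\<W>\<close>, on which the composite is contiguous to a projection;
  \<open>spread_independent\<close> carries the result back.\<close>

lemma canonical_spread:
  assumes x: "x \<in> carrier (cech_homology k (subtopology E X))"
    and \<U>: "\<U> \<in> open_coverings (subtopology E X)" and \<phi>: "canonical \<U> \<epsilon> \<phi>" and "0 < \<epsilon>"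
    and \<V>: "centred \<V> \<delta> a" and tube: "tube (nbhd \<epsilon>) \<delta>"
  shows "hom_induced (int k) (subtopology E (nbhd \<epsilon>)) {} (geometric_realization (nerve \<U>)) {} \<phi>
    (hom_induced (int k) (geometric_realization (nerve \<V>)) {} (subtopology E (nbhd \<epsilon>)) {}
      (r \<circ> barycentre \<V> a) (x \<V>)) = x \<U>"
proof -
  obtain \<delta>' where "0 < \<delta>'" and \<delta>':
    "\<And>x w. x \<in> X \<Longrightarrow> dist (e x) w < \<delta>' \<Longrightarrow> w \<in> O' \<and> dist (e x) (e (r w)) < \<epsilon>"
    using retraction_near_X [OF \<open>0 < \<epsilon>\<close>] by metis
  have r_top: "r w \<in> topspace E" if "w \<in> O'" for w
    using continuous_map_image_subset_topspace [OF cont_r] that by auto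
  have tube': "tube (nbhd \<epsilon>) \<delta>'"
    unfolding tube_def nbhd_def using \<delta>' r_top by blast
  obtain \<W> b where \<W>: "centred \<W> \<delta>' b" "refined_by \<U> \<W>"
    using centred_refinement [OF \<U> \<open>0 < \<delta>'\<close>] by blast
  have cov: "\<W> \<in> open_coverings (subtopology E X)" "finite \<W>"
    using \<W>(1) by (auto simp: centred_def)
  obtain p where p: "p \<in> projections \<U> \<W>"
    using projection_exists [OF \<W>(2)] by blast
  let ?N = "geometric_realization (nerve \<W>)"
  note cont = continuous_map_spread [OF \<W>(1) tube']
  have "homotopic_with (\<lambda>_. True) ?N (geometric_realization (nerve \<U>))
      (\<phi> \<circ> (r \<circ> barycentre \<W> b)) (realization_map p)"
  proof (rule nerve_map_homotopic)
    show "nerve_map ?N \<U> (\<phi> \<circ> (r \<circ> barycentre \<W> b))"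
      using \<phi> unfolding canonical_def by (intro nerve_map_compose [OF _ cont]) blast
    show "nerve_map ?N \<U> (realization_map p)"
      using nerve_map_projection [OF nerve_map_id [OF cov(2)] p] by simp
    fix t assume t: "t \<in> topspace ?N"
    obtain x where x: "x \<in> \<Union>\<W>" "\<forall>v. t v \<noteq> 0 \<longrightarrow> x \<in> v"
      using geometric_realization_nerve_common [OF t] by (elim bexE)
    have "x \<in> X" using x(1) centred_Union [OF \<W>(1)] by simp
    \<comment> \<open>The point \<open>x\<close> near \<open>z\<close> lies in all vertices of
      \<open>\<phi> z\<close> by canonicity, and in those of the projected point because
      \<open>p\<close> enlarges members of \<open>\<W>\<close>.\<close>
    define z where "z = r (barycentre \<W> b t)"
    have "dist (e x) (barycentre \<W> b t) < \<delta>'"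
      by (rule barycentre_near [OF \<W>(1) t x(2)])
    then have z: "z \<in> nbhd \<epsilon>" "dist (e x) (e z) < \<epsilon>"
      using \<delta>' [OF \<open>x \<in> X\<close>] r_top \<open>x \<in> X\<close> by (auto simp: nbhd_def z_def)
    have "x \<in> w" if w: "realization_map p t w \<noteq> 0" for w
    proof -
      obtain v where v: "t v \<noteq> 0" "p v = w" using w by (rule realization_map_support)
      then have "v \<in> \<W>" "x \<in> v"
        using geometric_realization_nerve_subset [OF cov(2)] t x(2)
        by (auto simp: geometric_simplex_def subset_iff)
      then show ?thesis using p v(2) by (auto simp: projections_def)
    qed
    moreover have "x \<in> w" if "\<phi> z w \<noteq> 0" for w
      using canonicalD [OF \<phi> z(1) that \<open>x \<in> X\<close> z(2)] .
    ultimately show "\<exists>x. \<forall>w. (\<phi> \<circ> (r \<circ> barycentre \<W> b)) t w \<noteq> 0 \<or> realization_map p t w \<noteq> 0 \<longrightarrow> x \<in> w"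
      unfolding z_def o_apply by blast
  qed
  then have "hom_induced (int k) ?N {} (geometric_realization (nerve \<U>)) {} (\<phi> \<circ> (r \<circ> barycentre \<W> b))
      = hom_induced (int k) ?N {} (geometric_realization (nerve \<U>)) {} (realization_map p)"
    by (rule homology_homotopy_empty)
  then have "hom_induced (int k) (subtopology E (nbhd \<epsilon>)) {} (geometric_realization (nerve \<U>)) {} \<phi>
      (hom_induced (int k) ?N {} (subtopology E (nbhd \<epsilon>)) {} (r \<circ> barycentre \<W> b) (x \<W>)) = x \<U>"
    using hom_induced_compose' [OF cont _ canonical_continuous [OF \<phi>]]
      covering_projection [OF x \<U> cov(1) p] by simp
  then show ?thesis
    using spread_independent [OF x \<V> tube \<W>(1) tube'] by simp
qed

text \<open>Canonical and spread maps are chosen separately for each covering and neighbourhood,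
  without coherence; the independence lemmas supply it on elements of the limits.\<close>

theorem cech_homology_nbhd_iso:
  "cech_homology_nbhd k E X \<cong> cech_homology k (subtopology E X)"
proof -
  have "\<exists>\<epsilon> \<phi>. 0 < \<epsilon> \<and> canonical \<U> \<epsilon> \<phi>" if "\<U> \<in> open_coverings (subtopology E X)" for \<U>
    using canonical_exists [OF that] by metis
  then obtain \<epsilon> \<phi> where can: "\<And>\<U>. \<U> \<in> open_coverings (subtopology E X) \<Longrightarrow> 0 < \<epsilon> \<U> \<and> canonical \<U> (\<epsilon> \<U>) (\<phi> \<U>)"
    by metis
  have "\<exists>\<delta> \<V> a. 0 < \<delta> \<and> tube U \<delta> \<and> centred \<V> \<delta> a" if U: "U \<in> open_neighbourhoods E X" for U
  proof -
    obtain \<delta> where \<delta>: "0 < \<delta>" "tube U \<delta>" using tube_exists [OF U] by blast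
    \<comment> \<open>The trivial covering is the one refined, since only smallness relative to
      \<open>\<delta>\<close> is wanted.\<close>
    have "{X} \<in> open_coverings (subtopology E X)"
      using X_subset by (auto simp: open_coverings_def openin_subtopology_refl)
    then obtain \<V> a where "centred \<V> \<delta> a" using centred_refinement \<delta>(1) by blast
    then show ?thesis using \<delta> by blast
  qed
  then obtain \<delta> \<V> a where cen: "\<And>U. U \<in> open_neighbourhoods E X \<Longrightarrow> 0 < \<delta> U \<and> tube U (\<delta> U) \<and> centred (\<V> U) (\<delta> U) (a U)"
    by metis
  have cov: "\<V> U \<in> open_coverings (subtopology E X)" if "U \<in> open_neighbourhoods E X" for U
    using cen [OF that] by (simp add: centred_def)
  have nb: "nbhd (\<epsilon> \<U>) \<in> open_neighbourhoods E X" if "\<U> \<in> open_coverings (subtopology E X)" for \<U>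
    using can [OF that] nbhd_open_neighbourhood by blast
  show ?thesis
    unfolding cech_homology_nbhd_def cech_homology_def
  \<comment> \<open>The limits are unfolded to fit the rule and folded back in its subgoals, where
    the lemmas speak of the named groups.\<close>
  proof (rule inverse_limit_iso [where \<alpha> = "\<lambda>\<U>. nbhd (\<epsilon> \<U>)" and \<beta> = \<V>
        and \<phi> = "\<lambda>\<U>. hom_induced (int k) (subtopology E (nbhd (\<epsilon> \<U>))) {} (geometric_realization (nerve \<U>)) {} (\<phi> \<U>)"
        and \<psi> = "\<lambda>U. hom_induced (int k) (geometric_realization (nerve (\<V> U))) {} (subtopology E U) {}
          (r \<circ> barycentre (\<V> U) (a U))"],
      unfold cech_homology_nbhd_def [symmetric] cech_homology_def [symmetric])
    fix y \<U> \<U>' f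
    assume y: "y \<in> carrier (cech_homology_nbhd k E X)"
      and \<U>: "\<U> \<in> open_coverings (subtopology E X)" and \<U>': "\<U>' \<in> open_coverings (subtopology E X)"
      and f: "f \<in> {hom_induced (int k) (geometric_realization (nerve \<U>')) {}
                  (geometric_realization (nerve \<U>)) {} (realization_map p) | p. p \<in> projections \<U> \<U>'}"
    obtain p where p: "p \<in> projections \<U> \<U>'"
      and f: "f = hom_induced (int k) (geometric_realization (nerve \<U>')) {}
                  (geometric_realization (nerve \<U>)) {} (realization_map p)"
      using f by blast
    \<comment> \<open>The projected canonical map for \<open>\<U>'\<close> is one more canonical map
      for \<open>\<U>\<close>.\<close>
    have "canonical \<U> (\<epsilon> \<U>') (realization_map p \<circ> \<phi> \<U>')"
      using can [OF \<U>'] p by (blast intro: canonical_projection)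
    then have "hom_induced (int k) (subtopology E (nbhd (\<epsilon> \<U>'))) {} (geometric_realization (nerve \<U>)) {}
        (realization_map p \<circ> \<phi> \<U>') (y (nbhd (\<epsilon> \<U>')))
      = hom_induced (int k) (subtopology E (nbhd (\<epsilon> \<U>))) {} (geometric_realization (nerve \<U>)) {} (\<phi> \<U>)
          (y (nbhd (\<epsilon> \<U>)))"
      using can [OF \<U>] can [OF \<U>'] by (intro canonical_independent [OF y]) auto
    moreover have cont: "continuous_map (subtopology E (nbhd (\<epsilon> \<U>'))) (geometric_realization (nerve \<U>')) (\<phi> \<U>')"
      using can [OF \<U>'] by (blast intro: canonical_continuous)
    ultimately show "f (hom_induced (int k) (subtopology E (nbhd (\<epsilon> \<U>'))) {} (geometric_realization (nerve \<U>')) {} (\<phi> \<U>')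
          (y (nbhd (\<epsilon> \<U>'))))
      = hom_induced (int k) (subtopology E (nbhd (\<epsilon> \<U>))) {} (geometric_realization (nerve \<U>)) {} (\<phi> \<U>) (y (nbhd (\<epsilon> \<U>)))"
      unfolding f
      using hom_induced_compose' [OF cont _ continuous_map_realization_projection [OF p]] by simp
  next
    fix x U V f
    assume x: "x \<in> carrier (cech_homology k (subtopology E X))"
      and U: "U \<in> open_neighbourhoods E X" and V: "V \<in> open_neighbourhoods E X"
      and f: "f \<in> (if V \<subseteq> U then {hom_induced (int k) (subtopology E V) {} (subtopology E U) {} id} else {})"
    have VU: "V \<subseteq> U" and f: "f = hom_induced (int k) (subtopology E V) {} (subtopology E U) {} id"
      using f by (auto split: if_splits)
    have V': "centred (\<V> V) (\<delta> V) (a V)" "tube V (\<delta> V)" using cen [OF V] by auto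
    \<comment> \<open>Enlarging the target keeps the tube, so the spread map chosen for
      \<open>V\<close> is also one for \<open>U\<close>.\<close>
    then have tube: "tube U (\<delta> V)" using VU unfolding tube_def by blast
    have U': "centred (\<V> U) (\<delta> U) (a U)" "tube U (\<delta> U)" using cen [OF U] by auto
    have "hom_induced (int k) (geometric_realization (nerve (\<V> V))) {} (subtopology E U) {}
          (r \<circ> barycentre (\<V> V) (a V)) (x (\<V> V))
      = hom_induced (int k) (geometric_realization (nerve (\<V> U))) {} (subtopology E U) {}
          (r \<circ> barycentre (\<V> U) (a U)) (x (\<V> U))"
      by (rule spread_independent [OF x V'(1) tube U'])
    then show "f (hom_induced (int k) (geometric_realization (nerve (\<V> V))) {} (subtopology E V) {}
          (r \<circ> barycentre (\<V> V) (a V)) (x (\<V> V)))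
      = hom_induced (int k) (geometric_realization (nerve (\<V> U))) {} (subtopology E U) {}
          (r \<circ> barycentre (\<V> U) (a U)) (x (\<V> U))"
      unfolding f
      using hom_induced_compose' [OF continuous_map_spread [OF V'] _ continuous_map_inclusion [OF VU]]
      by simp
  next
    fix y U assume y: "y \<in> carrier (cech_homology_nbhd k E X)" and U: "U \<in> open_neighbourhoods E X"
    show "hom_induced (int k) (geometric_realization (nerve (\<V> U))) {} (subtopology E U) {}
          (r \<circ> barycentre (\<V> U) (a U))
        (hom_induced (int k) (subtopology E (nbhd (\<epsilon> (\<V> U)))) {} (geometric_realization (nerve (\<V> U))) {} (\<phi> (\<V> U))
          (y (nbhd (\<epsilon> (\<V> U))))) = y U"
      using cen [OF U] can [OF cov [OF U]] by (intro spread_canonical [OF y U]) auto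
  next
    fix x \<U> assume x: "x \<in> carrier (cech_homology k (subtopology E X))"
      and \<U>: "\<U> \<in> open_coverings (subtopology E X)"
    show "hom_induced (int k) (subtopology E (nbhd (\<epsilon> \<U>))) {} (geometric_realization (nerve \<U>)) {} (\<phi> \<U>)
        (hom_induced (int k) (geometric_realization (nerve (\<V> (nbhd (\<epsilon> \<U>))))) {} (subtopology E (nbhd (\<epsilon> \<U>))) {}
          (r \<circ> barycentre (\<V> (nbhd (\<epsilon> \<U>))) (a (nbhd (\<epsilon> \<U>)))) (x (\<V> (nbhd (\<epsilon> \<U>))))) = x \<U>"
      using cen [OF nb [OF \<U>]] can [OF \<U>] by (intro canonical_spread [OF x \<U>]) auto
  qed (auto intro: cov nb hom_induced_hom hom_induced_carrier)
qed

end

theorem mainTheorem2: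
  fixes E :: "'a topology" and X :: "'a set" and Y :: "(real ^ 'n) set" and k :: nat
  assumes "ENR Y" and "E homeomorphic_space top_of_set Y"
    and "compact_space E"
    and "compactin E X"
  shows "cech_homology_nbhd k E X \<cong> cech_homology k (subtopology E X)"
proof -
  obtain O' \<rho> where O': "open O'" and \<rho>: "retraction O' Y \<rho>"
    using assms(1) by (auto simp: ENR_def retract_of_def)
  obtain e g where e: "continuous_map E (top_of_set Y) e" and g: "continuous_map (top_of_set Y) E g"
    and ge: "\<And>z. z \<in> topspace E \<Longrightarrow> g (e z) = z"
    using assms(2) by (auto simp: homeomorphic_space_def homeomorphic_maps_def)
  have eY: "e z \<in> Y" if "z \<in> topspace E" for z
    using continuous_map_image_subset_topspace [OF e] that by auto
  \<comment> \<open>The map \<open>g \<circ> \<rho>\<close> inverts \<open>e\<close> on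
    \<open>E\<close> because \<open>\<rho>\<close> fixes \<open>Y\<close> pointwise.\<close>
  interpret compact_in_neighbourhood_retract E X e O' "g \<circ> \<rho>"
  proof
    show "compactin E X" by fact
    show "continuous_map E euclidean e" using e by (simp add: continuous_map_in_subtopology)
    show "open O'" by fact
    have "continuous_map (top_of_set O') (top_of_set Y) \<rho>"
      using \<rho> by (simp add: retraction_def)
    then show "continuous_map (top_of_set O') E (g \<circ> \<rho>)"
      using g by (rule continuous_map_compose)
    show "e z \<in> O'" "(g \<circ> \<rho>) (e z) = z" if "z \<in> topspace E" for z
      using that eY [OF that] ge \<rho> by (auto simp: retraction_def)
  qed
  show ?thesis by (rule cech_homology_nbhd_iso)
qed

end
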